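(* Let $p$ be a prime. Every finite Moufang $p$-loop is centrally nilpotent.
   Context: A Moufang loop is a loop satisfying $(xy\cdot x)z = x(y\cdot xz)$. A finite Moufang $p$-loop is a finite Moufang loop whose order is a power of the prime $p$. The center of a loop $Q$ is the normal subloop $Z(Q)=\{x\in Q : x\cdot yz=xy\cdot z,\ zy\cdot x=z\cdot yx,\ xy=yx\ \ \forall y,z\in Q\}$. Put $Z_0(Q)=\{1\}$, $Z_1(Q)=Z(Q)$ and define $Z_{i+1}(Q)$ inductively by $Z_{i+1}(Q)/Z_i(Q)=Z(Q/Z_i(Q))$. The loop $Q$ is centrally nilpotent if $Z_n(Q)=Q$ for some $n$. *)

theory Defs
  imports "HOL-Algebra.Coset" "HOL-Computational_Algebra.Primes"
begin

locale loop =
  fixes Q :: "('a, 'b) monoid_scheme" (structure)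
  assumes mult_closed: "\<lbrakk>x \<in> carrier Q; y \<in> carrier Q\<rbrakk> \<Longrightarrow> x \<otimes> y \<in> carrier Q"
    and one_closed: "\<one> \<in> carrier Q"
    and left_one: "x \<in> carrier Q \<Longrightarrow> \<one> \<otimes> x = x"
    and right_one: "x \<in> carrier Q \<Longrightarrow> x \<otimes> \<one> = x"
    and left_division:
      "\<lbrakk>a \<in> carrier Q; b \<in> carrier Q\<rbrakk> \<Longrightarrow> \<exists>!x. x \<in> carrier Q \<and> a \<otimes> x = b"
    and right_division:
      "\<lbrakk>a \<in> carrier Q; b \<in> carrier Q\<rbrakk> \<Longrightarrow> \<exists>!y. y \<in> carrier Q \<and> y \<otimes> a = b"

locale moufang_loop = loop +
  assumes moufang:
    "\<lbrakk>x \<in> carrier Q; y \<in> carrier Q; z \<in> carrier Q\<rbrakk>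
      \<Longrightarrow> ((x \<otimes> y) \<otimes> x) \<otimes> z = x \<otimes> (y \<otimes> (x \<otimes> z))"

definition finite_moufang_p_loop :: "nat \<Rightarrow> ('a, 'b) monoid_scheme \<Rightarrow> bool" where
  "finite_moufang_p_loop p Q \<longleftrightarrow>
     moufang_loop Q \<and> finite (carrier Q) \<and> (\<exists>n. order Q = p ^ n)"

definition loop_center :: "('a, 'b) monoid_scheme \<Rightarrow> 'a set" where
  "loop_center Q = {x \<in> carrier Q. \<forall>y \<in> carrier Q. \<forall>z \<in> carrier Q.
     x \<otimes>\<^bsub>Q\<^esub> (y \<otimes>\<^bsub>Q\<^esub> z) = (x \<otimes>\<^bsub>Q\<^esub> y) \<otimes>\<^bsub>Q\<^esub> z \<and>
     (z \<otimes>\<^bsub>Q\<^esub> y) \<otimes>\<^bsub>Q\<^esub> x = z \<otimes>\<^bsub>Q\<^esub> (y \<otimes>\<^bsub>Q\<^esub> x) \<and>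
     x \<otimes>\<^bsub>Q\<^esub> y = y \<otimes>\<^bsub>Q\<^esub> x}"

(* The quotient is the library's FactGroup: its carrier consists of the cosets N x and its
   product is the setwise product.  No group axioms enter its definition, and for a normal
   subloop N of a loop one has N x = x N and (N x)(N y) = N (x y), so it is the quotient loop. *)
primrec upper_center :: "('a, 'b) monoid_scheme \<Rightarrow> nat \<Rightarrow> 'a set" where
  "upper_center Q 0 = {\<one>\<^bsub>Q\<^esub>}"
| "upper_center Q (Suc i) =
     {x \<in> carrier Q. upper_center Q i #>\<^bsub>Q\<^esub> x \<in> loop_center (Q Mod upper_center Q i)}"

lemma carrier_upper_center_quotient:
  "carrier (Q\<lparr>carrier := upper_center Q (Suc i)\<rparr> Mod upper_center Q i)
     = loop_center (Q Mod upper_center Q i)"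
  by (auto simp: FactGroup_def RCOSETS_def r_coset_def loop_center_def)

lemma (in loop) upper_center_1: "upper_center Q 1 = loop_center Q"
proof -
  have coset: "{\<one>} #> x = {x}" if "x \<in> carrier Q" for x
    using that by (simp add: r_coset_def left_one)
  have carr: "carrier (Q Mod {\<one>}) = (\<lambda>x. {x}) ` carrier Q"
    by (auto simp: carrier_FactGroup coset image_iff)
  have center: "{x} \<in> loop_center (Q Mod {\<one>}) \<longleftrightarrow> x \<in> loop_center Q" if "x \<in> carrier Q" for x
    using that unfolding loop_center_def carr
    by (auto simp: set_mult_def)
  have "upper_center Q 1 = {x \<in> carrier Q. x \<in> loop_center Q}"
    using coset center by auto
  then show ?thesis
    by (auto simp: loop_center_def)
qed

definition centrally_nilpotent :: "('a, 'b) monoid_scheme \<Rightarrow> bool" where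
  "centrally_nilpotent Q \<longleftrightarrow> (\<exists>n. upper_center Q n = carrier Q)"

end

(* For a Moufang loop Q and x in Q let t_x be the involution on the disjoint union of the columns and
   the entries of the multiplication table that exchanges column z with entry x z. The set D of
   all t_x is closed under conjugation, since t_x t_y t_x = t_(x y^-1 x) by the Moufang identity,
   and |D| = |Q| is a power of p. As (t_x t_y)^k has the form t_u t_y, it is trivial as soon as it has
   a fixed point, so all products t_x t_y have p-power order.

   It follows that these products lie in a common p-group: for p = 2 by the Baer-Suzuki argument, and
   for odd p because D is a conjugacy class of p-power length. Hence the left multiplication group of Q
   is a p-group, and so is the right one, by passing to the opposite loop. The right multiplication
   group normalizes the left one, so the multiplication group is a p-group. Its center is nontrivial
   and provides a nontrivial center of Q; quotients of Q inherit all assumptions. *)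

theory Submission
  imports Defs "HOL-Algebra.Group_Action" "HOL-Algebra.Sylow" "HOL-Algebra.Generated_Groups"
    "HOL-Algebra.Multiplicative_Group"
begin

section \<open>Actions of \<open>p\<close>-subgroups\<close>

text \<open>Generators of p-power order need not generate a p-group, and the left translations L_x
  are not closed under conjugation: only L_x L_y L_x is again one of them. Replacing L_x by the
  involution t_x turns this twisted closure into genuine invariance under conjugation, at the price
  of a second copy of Q. Nothing is lost, since t_x t_1 acts on the entries as L_x.

  The parities of p separate because t_x is itself a p-element only for p = 2. For odd p merely the
  products can lie in a p-group; in exchange, their odd order supplies square roots. These make D a
  single conjugacy class, so that the centralizer of an involution has index p^n and a p-group
  together with this centralizer can fill the whole group.\<close>

definition p_subgroup :: "nat \<Rightarrow> ('a, 'b) monoid_scheme \<Rightarrow> 'a set \<Rightarrow> bool" where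
  "p_subgroup p G H \<longleftrightarrow> subgroup H G \<and> (\<exists>n. card H = p ^ n)"

lemma p_subgroupD: "p_subgroup p G H \<Longrightarrow> subgroup H G"
  by (simp add: p_subgroup_def)

lemma p_subgroup_finite: "prime p \<Longrightarrow> p_subgroup p G H \<Longrightarrow> finite H"
  by (rule card_ge_0_finite) (auto simp: p_subgroup_def prime_gt_0_nat)

lemma p_subgroupI_dvd:
  assumes "prime p" "subgroup H G" "card H dvd p ^ n"
  shows "p_subgroup p G H"
  using assms divides_primepow_nat[of p "card H" n] by (auto simp: p_subgroup_def)

text \<open>Library actions are homomorphisms into a group of extensional bijections. Here
  \<open>act\<close> is constrained on \<open>E\<close> only, so that conjugation, multiplication of
  cosets and evaluation of permutations fit unchanged; \<open>group_action\<close>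
  translates.\<close>

locale finite_action = group G for G (structure) +
  fixes P :: "'a set" and E :: "'c set" and act :: "'a \<Rightarrow> 'c \<Rightarrow> 'c"
  assumes subgroup: "subgroup P G"
    and finite_P: "finite P"
    and finite_E: "finite E"
    and act_closed: "\<lbrakk>g \<in> P; x \<in> E\<rbrakk> \<Longrightarrow> act g x \<in> E"
    and act_one: "x \<in> E \<Longrightarrow> act \<one> x = x"
    and act_mult: "\<lbrakk>g \<in> P; h \<in> P; x \<in> E\<rbrakk> \<Longrightarrow> act (g \<otimes> h) x = act g (act h x)"
begin

lemma inv_P: "g \<in> P \<Longrightarrow> inv g \<in> P"
  using subgroup subgroup.m_inv_closed by metis

lemma inverse_act:
  assumes "g \<in> P" "x \<in> E"
  shows "act (inv g) (act g x) = x"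
proof -
  have "act (inv g) (act g x) = act (inv g \<otimes> g) x"
    using assms inv_P act_mult by simp
  also have "inv g \<otimes> g = \<one>"
    using assms subgroup.mem_carrier[OF subgroup] by simp
  finally show ?thesis
    using assms act_one by simp
qed

lemma act_inverse:
  assumes "g \<in> P" "x \<in> E"
  shows "act g (act (inv g) x) = x"
  using inverse_act[of "inv g" x] inv_P[of g] assms subgroup.mem_carrier[OF subgroup] by simp

lemma group_action: "group_action (G\<lparr>carrier := P\<rparr>) E (\<lambda>g. restrict (act g) E)"
proof -
  interpret P: group "G\<lparr>carrier := P\<rparr>"
    using subgroup by (rule subgroup_imp_group)
  have bij: "restrict (act g) E \<in> Bij E" if g: "g \<in> P" for g
  proof -
    have "bij_betw (act g) E E"
    proof (rule bij_betw_byWitness[where f' = "act (inv g)"])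
      show "\<forall>x\<in>E. act (inv g) (act g x) = x" "\<forall>x\<in>E. act g (act (inv g) x) = x"
        using inverse_act act_inverse g by auto
      show "act g ` E \<subseteq> E" "act (inv g) ` E \<subseteq> E"
        using act_closed g inv_P by auto
    qed
    then have "bij_betw (restrict (act g) E) E E"
      by (simp cong: bij_betw_cong)
    then show ?thesis
      by (simp add: Bij_def)
  qed
  have "(\<lambda>g. restrict (act g) E) \<in> hom (G\<lparr>carrier := P\<rparr>) (BijGroup E)"
  proof (rule homI)
    fix g h assume "g \<in> carrier (G\<lparr>carrier := P\<rparr>)" "h \<in> carrier (G\<lparr>carrier := P\<rparr>)"
    then have gh: "g \<in> P" "h \<in> P" by auto
    have "restrict (act (g \<otimes> h)) E = compose E (restrict (act g) E) (restrict (act h) E)"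
      using gh act_mult act_closed by (auto simp: compose_def)
    then show "restrict (act (g \<otimes>\<^bsub>G\<lparr>carrier := P\<rparr>\<^esub> h)) E
        = restrict (act g) E \<otimes>\<^bsub>BijGroup E\<^esub> restrict (act h) E"
      using bij gh by (simp add: BijGroup_def)
  qed (use bij in \<open>simp add: BijGroup_def\<close>)
  then show ?thesis
    by (auto simp: group_action_def group_hom_def group_hom_axioms_def group_BijGroup P.is_group)
qed

text \<open>Orbits partition \<open>E\<close>. The divisor \<open>k\<close> will be p for orbits
  without fixed points, and the group order for an action with trivial stabilizers.\<close>

lemma dvd_card_of_dvd_orbits:
  assumes "\<And>x. x \<in> E \<Longrightarrow> k dvd card {act g x | g. g \<in> P}"
  shows "k dvd card E"
proof -
  interpret A: group_action "G\<lparr>carrier := P\<rparr>" E "\<lambda>g. restrict (act g) E"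
    by (rule group_action)
  let ?O = "orbits (G\<lparr>carrier := P\<rparr>) E (\<lambda>g. restrict (act g) E)"
  have part: "partition E ?O"
    by (rule A.orbit_partition)
  then have cover: "\<Union>?O = E" by (rule partition.partition_coverture)
  have "k dvd card (\<Union>?O)"
  proof (rule dvd_partition)
    show "finite (\<Union>?O)" using cover finite_E by simp
    show "\<forall>c\<in>?O. k dvd card c"
      using assms by (auto simp: orbits_def orbit_def)
    show "\<forall>c1\<in>?O. \<forall>c2\<in>?O. c1 \<noteq> c2 \<longrightarrow> c1 \<inter> c2 = {}"
      using A.disjoint_union by blast
  qed
  then show ?thesis using cover by simp
qed

lemma orbit_stabilizer:
  assumes "x \<in> E"
  shows "card {act g x | g. g \<in> P} * card {g \<in> P. act g x = x} = card P"
proof -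
  interpret A: group_action "G\<lparr>carrier := P\<rparr>" E "\<lambda>g. restrict (act g) E"
    by (rule group_action)
  have "orbit (G\<lparr>carrier := P\<rparr>) (\<lambda>g. restrict (act g) E) x = {act g x | g. g \<in> P}"
    "stabilizer (G\<lparr>carrier := P\<rparr>) (\<lambda>g. restrict (act g) E) x = {g \<in> P. act g x = x}"
    using assms by (auto simp: orbit_def stabilizer_def)
  then show ?thesis
    using A.orbit_stabilizer_theorem[OF assms] by (simp add: order_def)
qed

end

lemma (in finite_action) prime_dvd_card_of_no_fixed_point:
  assumes p: "prime p" and P: "p_subgroup p G P"
    and nofix: "\<And>x. x \<in> E \<Longrightarrow> \<exists>g\<in>P. act g x \<noteq> x"
  shows "p dvd card E"
proof (rule dvd_card_of_dvd_orbits)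
  fix x assume x: "x \<in> E"
  obtain n where n: "card P = p ^ n" using P by (auto simp: p_subgroup_def)
  define Orb where "Orb = {act g x | g. g \<in> P}"
  have "card Orb dvd p ^ n"
    unfolding Orb_def n[symmetric] by (rule dvdI[OF orbit_stabilizer[OF x, symmetric]])
  then obtain k where k: "card Orb = p ^ k" using divides_primepow_nat[OF p] by metis
  obtain g where g: "g \<in> P" "act g x \<noteq> x" using nofix x by blast
  have "\<one> \<in> P" using subgroup subgroup.one_closed by auto
  then have "act \<one> x \<in> Orb" unfolding Orb_def by blast
  then have "x \<in> Orb" using act_one[OF x] by simp
  moreover have "act g x \<in> Orb" using g(1) unfolding Orb_def by blast
  moreover have "finite Orb" using finite_P unfolding Orb_def by simp
  ultimately have "card {x, act g x} \<le> card Orb" by (simp add: card_mono)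
  moreover have "card {x, act g x} = 2" using g(2) by simp
  ultimately have "k \<noteq> 0" using k by (intro notI) simp
  then have "p dvd card Orb" using k by simp
  then show "p dvd card {act g x | g. g \<in> P}" unfolding Orb_def .
qed

text \<open>The moved points form an invariant set: an image fixed by all of \<open>P\<close> is
  fixed by the inverse of the element that produced it, hence equals its preimage. No fixed point
  remains there, so p divides its size.\<close>

lemma (in finite_action) card_fixed_points_mod:
  assumes p: "prime p" and P: "p_subgroup p G P"
  shows "card {x \<in> E. \<forall>g\<in>P. act g x = x} mod p = card E mod p"
proof -
  define F where "F = {x \<in> E. \<forall>g\<in>P. act g x = x}"
  have cl: "act g x \<in> E - F" if g: "g \<in> P" and x: "x \<in> E - F" for g x
  proof
    show "act g x \<in> E" using act_closed g x by simp
    show "act g x \<notin> F"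
    proof
      assume "act g x \<in> F"
      then have fixd: "act h (act g x) = act g x" if "h \<in> P" for h
        using that by (simp add: F_def)
      have "act g x = x"
        using fixd[OF inv_P[OF g]] inverse_act[of g x] g x by simp
      with fixd x show False by (simp add: F_def)
    qed
  qed
  interpret F: finite_action G P "E - F" act
  proof (intro finite_action.intro finite_action_axioms.intro group_axioms)
    show "subgroup P G" "finite P" "finite (E - F)"
      using subgroup finite_P finite_E by simp_all
    show "act \<one> x = x" if "x \<in> E - F" for x
      using that act_one by simp
    show "act (g \<otimes> h) x = act g (act h x)" if "g \<in> P" "h \<in> P" "x \<in> E - F" for g h x
      using that act_mult by simp
  qed (rule cl)
  have "p dvd card (E - F)"
  proof (rule F.prime_dvd_card_of_no_fixed_point[OF p P])
    fix x assume "x \<in> E - F"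
    then show "\<exists>g\<in>P. act g x \<noteq> x" by (simp add: F_def)
  qed
  then obtain c where c: "card (E - F) = p * c" by (rule dvdE)
  have F: "finite F" "F \<subseteq> E" using finite_E by (simp_all add: F_def)
  then have "card E = card (E - F) + card F"
    using card_Diff_subset[OF F] card_mono[OF finite_E F(2)] by simp
  then show ?thesis by (simp add: c flip: F_def)
qed

section \<open>Conjugation, products of subgroups and normalizers\<close>

context group
begin

lemma conj_mult:
  "\<lbrakk>g \<in> carrier G; x \<in> carrier G; y \<in> carrier G\<rbrakk>
    \<Longrightarrow> g \<otimes> (x \<otimes> y) \<otimes> inv g = (g \<otimes> x \<otimes> inv g) \<otimes> (g \<otimes> y \<otimes> inv g)"
  by (simp add: m_assoc inv_solve_left)

lemma conj_inv:
  "\<lbrakk>g \<in> carrier G; x \<in> carrier G\<rbrakk> \<Longrightarrow> g \<otimes> inv x \<otimes> inv g = inv (g \<otimes> x \<otimes> inv g)"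
  by (simp add: m_assoc inv_mult_group)

lemma conj_conj:
  "\<lbrakk>g \<in> carrier G; h \<in> carrier G; x \<in> carrier G\<rbrakk>
    \<Longrightarrow> (g \<otimes> h) \<otimes> x \<otimes> inv (g \<otimes> h) = g \<otimes> (h \<otimes> x \<otimes> inv h) \<otimes> inv g"
  by (simp add: m_assoc inv_mult_group)

text \<open>The fibre of the multiplication over a b consists of the pairs (a t, t^-1 b) with t in
  the intersection. The product set may fail to be a subgroup, which permits using the formula to
  show that such a product is the whole group.\<close>

lemma card_set_mult:
  assumes A: "subgroup A G" and B: "subgroup B G" and fin: "finite A" "finite B"
  shows "card (A <#> B) * card (A \<inter> B) = card A * card B"
proof -
  note Ac = subgroup.mem_carrier[OF A] and Bc = subgroup.mem_carrier[OF B]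
  define f where "f = (\<lambda>(a, b). a \<otimes> b)"
  have img: "f ` (A \<times> B) = A <#> B"
    by (force simp: f_def set_mult_def)
  have fibre: "card {x \<in> A \<times> B. f x = y} = card (A \<inter> B)" if y: "y \<in> A <#> B" for y
  proof -
    obtain a b where ab: "a \<in> A" "b \<in> B" "y = a \<otimes> b"
      using y by (auto simp: set_mult_def)
    have "bij_betw (\<lambda>t. (a \<otimes> t, inv t \<otimes> b)) (A \<inter> B) {x \<in> A \<times> B. f x = y}"
    proof (rule bij_betw_byWitness[where f' = "\<lambda>x. inv a \<otimes> fst x"])
      show "\<forall>t\<in>A \<inter> B. inv a \<otimes> fst (a \<otimes> t, inv t \<otimes> b) = t"
        using ab Ac by (simp flip: m_assoc)
      show "\<forall>x\<in>{x \<in> A \<times> B. f x = y}. (a \<otimes> (inv a \<otimes> fst x), inv (inv a \<otimes> fst x) \<otimes> b) = x"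
      proof
        fix x assume "x \<in> {x \<in> A \<times> B. f x = y}"
        then obtain c d where x: "x = (c, d)" "c \<in> A" "d \<in> B" and eq: "c \<otimes> d = a \<otimes> b"
          using ab by (auto simp: f_def)
        note cl = Ac[OF ab(1)] Bc[OF ab(2)] Ac[OF x(2)] Bc[OF x(3)]
        have "a \<otimes> (inv a \<otimes> c) = c" using cl by (simp flip: m_assoc)
        moreover have "inv (inv a \<otimes> c) \<otimes> b = inv c \<otimes> (a \<otimes> b)"
          using cl by (simp add: inv_mult_group m_assoc)
        moreover have "inv c \<otimes> (a \<otimes> b) = d"
          unfolding eq[symmetric] using cl by (simp flip: m_assoc)
        ultimately show "(a \<otimes> (inv a \<otimes> fst x), inv (inv a \<otimes> fst x) \<otimes> b) = x"
          using x by simp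
      qed
      show "(\<lambda>t. (a \<otimes> t, inv t \<otimes> b)) ` (A \<inter> B) \<subseteq> {x \<in> A \<times> B. f x = y}"
      proof
        fix x assume "x \<in> (\<lambda>t. (a \<otimes> t, inv t \<otimes> b)) ` (A \<inter> B)"
        then obtain t where t: "t \<in> A" "t \<in> B" "x = (a \<otimes> t, inv t \<otimes> b)" by blast
        note cl = Ac[OF ab(1)] Bc[OF ab(2)] Ac[OF t(1)]
        have "a \<otimes> t \<otimes> (inv t \<otimes> b) = a \<otimes> (t \<otimes> inv t) \<otimes> b"
          using cl by (simp only: m_assoc m_closed inv_closed)
        also have "\<dots> = a \<otimes> b" using cl by simp
        finally have "a \<otimes> t \<otimes> (inv t \<otimes> b) = a \<otimes> b" .
        then show "x \<in> {x \<in> A \<times> B. f x = y}"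
          using t ab subgroup.m_closed[OF A] subgroup.m_closed[OF B] subgroup.m_inv_closed[OF B]
          by (simp add: f_def)
      qed
      show "(\<lambda>x. inv a \<otimes> fst x) ` {x \<in> A \<times> B. f x = y} \<subseteq> A \<inter> B"
      proof
        fix t assume "t \<in> (\<lambda>x. inv a \<otimes> fst x) ` {x \<in> A \<times> B. f x = y}"
        then obtain c d where x: "t = inv a \<otimes> c" "c \<in> A" "d \<in> B" and eq: "c \<otimes> d = a \<otimes> b"
          using ab by (auto simp: f_def)
        note cl = Ac[OF ab(1)] Bc[OF ab(2)] Ac[OF x(2)] Bc[OF x(3)]
        have "c = a \<otimes> b \<otimes> inv d"
          unfolding eq[symmetric] using cl by (simp add: m_assoc)
        then have "inv a \<otimes> c = (inv a \<otimes> a) \<otimes> (b \<otimes> inv d)"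
          using cl by (simp only: m_assoc m_closed inv_closed)
        then have "inv a \<otimes> c = b \<otimes> inv d" using cl by simp
        then have "t \<in> B"
          using x ab subgroup.m_closed[OF B] subgroup.m_inv_closed[OF B] by simp
        moreover have "t \<in> A"
          using x ab subgroup.m_closed[OF A] subgroup.m_inv_closed[OF A] by simp
        ultimately show "t \<in> A \<inter> B" by simp
      qed
    qed
    then show ?thesis by (simp add: bij_betw_same_card)
  qed
  have "card A * card B = (\<Sum>x\<in>A \<times> B. 1)"
    by (simp add: card_cartesian_product)
  also have "\<dots> = (\<Sum>y\<in>f ` (A \<times> B). \<Sum>x\<in>{x \<in> A \<times> B. f x = y}. 1)"
    using fin by (intro sum.image_gen) simp
  also have "\<dots> = (\<Sum>y\<in>A <#> B. card (A \<inter> B))"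
    unfolding img by (rule sum.cong) (simp_all add: fibre)
  finally show ?thesis by simp
qed

lemma subgroup_set_mult:
  assumes A: "subgroup A G" and B: "subgroup B G"
    and norm: "\<And>a b. \<lbrakk>a \<in> A; b \<in> B\<rbrakk> \<Longrightarrow> b \<otimes> a \<otimes> inv b \<in> A"
  shows "subgroup (A <#> B) G" "A \<subseteq> A <#> B" "B \<subseteq> A <#> B"
proof -
  note Ac = subgroup.mem_carrier[OF A] and Bc = subgroup.mem_carrier[OF B]
  show incl: "A \<subseteq> A <#> B"
  proof
    fix a assume a: "a \<in> A"
    have "a \<otimes> \<one> \<in> A <#> B"
      using a subgroup.one_closed[OF B] by (auto simp: set_mult_def)
    then show "a \<in> A <#> B" using Ac[OF a] by simp
  qed
  show "B \<subseteq> A <#> B"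
  proof
    fix b assume b: "b \<in> B"
    have "\<one> \<otimes> b \<in> A <#> B"
      using b subgroup.one_closed[OF A] by (auto simp: set_mult_def)
    then show "b \<in> A <#> B" using Bc[OF b] by simp
  qed
  show "subgroup (A <#> B) G"
  proof (rule subgroupI)
    show "A <#> B \<subseteq> carrier G"
      using A B by (simp add: setmult_subset_G subgroup.subset)
    show "A <#> B \<noteq> {}" using incl subgroup.one_closed[OF A] by auto
  next
    fix x assume "x \<in> A <#> B"
    then obtain a b where ab: "a \<in> A" "b \<in> B" "x = a \<otimes> b" by (auto simp: set_mult_def)
    note cl = Ac[OF ab(1)] Bc[OF ab(2)]
    have "inv x = (inv b \<otimes> inv a \<otimes> inv (inv b)) \<otimes> inv b"
      using cl by (simp add: ab(3) inv_mult_group m_assoc)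
    then show "inv x \<in> A <#> B"
      using ab norm[of "inv a" "inv b"] subgroup.m_inv_closed[OF A] subgroup.m_inv_closed[OF B]
      by (auto simp: set_mult_def)
  next
    fix x y assume "x \<in> A <#> B" "y \<in> A <#> B"
    then obtain a b c d where ab: "a \<in> A" "b \<in> B" "x = a \<otimes> b" "c \<in> A" "d \<in> B" "y = c \<otimes> d"
      by (auto simp: set_mult_def)
    note cl = Ac[OF ab(1)] Bc[OF ab(2)] Ac[OF ab(4)] Bc[OF ab(5)]
    have "x \<otimes> y = (a \<otimes> (b \<otimes> c \<otimes> inv b)) \<otimes> (b \<otimes> d)"
      using cl unfolding ab by (simp add: m_assoc inv_solve_left)
    moreover have "a \<otimes> (b \<otimes> c \<otimes> inv b) \<in> A"
      using ab norm[of c b] subgroup.m_closed[OF A] by simp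
    moreover have "b \<otimes> d \<in> B"
      using ab subgroup.m_closed[OF B] by simp
    ultimately show "x \<otimes> y \<in> A <#> B"
      by (auto simp: set_mult_def)
  qed
qed

lemma p_subgroup_set_mult:
  assumes p: "prime p" and A: "p_subgroup p G A" and B: "p_subgroup p G B"
    and norm: "\<And>a b. \<lbrakk>a \<in> A; b \<in> B\<rbrakk> \<Longrightarrow> b \<otimes> a \<otimes> inv b \<in> A"
  shows "p_subgroup p G (A <#> B)"
proof -
  obtain m n where "card A = p ^ m" "card B = p ^ n"
    using A B by (auto simp: p_subgroup_def)
  moreover have "card (A <#> B) dvd card A * card B"
    using card_set_mult[OF p_subgroupD[OF A] p_subgroupD[OF B]
        p_subgroup_finite[OF p A] p_subgroup_finite[OF p B]]
    by (rule dvdI[OF sym])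
  ultimately have "card (A <#> B) dvd p ^ (m + n)"
    by (simp add: power_add)
  moreover have "subgroup (A <#> B) G"
    using p_subgroupD[OF A] p_subgroupD[OF B] norm by (rule subgroup_set_mult(1))
  ultimately show ?thesis
    by (intro p_subgroupI_dvd[OF p])
qed

lemma card_subgroup_dvd:
  assumes "subgroup H G" "subgroup K G" "H \<subseteq> K"
  shows "card H dvd card K"
proof -
  interpret K: group "G\<lparr>carrier := K\<rparr>"
    using assms(2) by (rule subgroup_imp_group)
  have "subgroup H (G\<lparr>carrier := K\<rparr>)"
    using assms by (rule subgroup_incl)
  from K.lagrange[OF this]
  have "card K = card H * card (rcosets\<^bsub>G\<lparr>carrier := K\<rparr>\<^esub> H)"
    by (simp add: order_def mult.commute)
  then show ?thesis by (rule dvdI)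
qed

lemma p_subgroup_mono:
  assumes p: "prime p" and K: "p_subgroup p G K" and H: "subgroup H G" "H \<subseteq> K"
  shows "p_subgroup p G H"
proof -
  obtain n where n: "card K = p ^ n" using K by (auto simp: p_subgroup_def)
  show ?thesis
    using card_subgroup_dvd[OF H(1) p_subgroupD[OF K] H(2)] unfolding n
    by (rule p_subgroupI_dvd[OF p H(1)])
qed

lemma p_subgroup_generate_single:
  assumes p: "prime p" and u: "u \<in> carrier G" "u [^] (p ^ k) = \<one>"
  shows "p_subgroup p G (generate G {u})"
proof (rule p_subgroupI_dvd[OF p])
  show "subgroup (generate G {u}) G" using u by (simp add: generate_is_subgroup)
  show "card (generate G {u}) dvd p ^ k"
    using u pow_eq_id[of u "p ^ k"] by (simp add: generate_pow_card)
qed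

text \<open>Conjugation respects products in both arguments, so inductions over the two generated
  subgroups reduce to generators. \<open>S\<close> is closed under inverses because conjugation
  might map an infinite subgroup properly into itself.\<close>

lemma generate_conj:
  assumes S: "S \<subseteq> carrier G" and T: "T \<subseteq> carrier G"
    and S_inv: "\<And>g. g \<in> S \<Longrightarrow> inv g \<in> S"
    and conj: "\<And>g h. \<lbrakk>g \<in> S; h \<in> T\<rbrakk> \<Longrightarrow> g \<otimes> h \<otimes> inv g \<in> generate G T"
    and g: "g \<in> generate G S" and h: "h \<in> generate G T"
  shows "g \<otimes> h \<otimes> inv g \<in> generate G T"
proof -
  note gT = generate_in_carrier[OF T] and gS = generate_in_carrier[OF S]
  have one: "\<one> \<in> generate G T" by (rule generate.one)
  have *: "s \<otimes> h \<otimes> inv s \<in> generate G T" if s: "s \<in> S" and h: "h \<in> generate G T" for s h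
    using h
  proof induction
    case one
    then show ?case using s S generate.one[of G T] by (auto simp: subset_eq)
  next
    case (incl h)
    then show ?case using conj s by simp
  next
    case (inv h)
    then have "s \<otimes> inv h \<otimes> inv s = inv (s \<otimes> h \<otimes> inv s)"
      using s S T by (intro conj_inv) auto
    then show ?case using conj[OF s inv] generate_m_inv_closed[OF T] by simp
  next
    case (eng h1 h2)
    then have "s \<otimes> (h1 \<otimes> h2) \<otimes> inv s = (s \<otimes> h1 \<otimes> inv s) \<otimes> (s \<otimes> h2 \<otimes> inv s)"
      using s S gT by (intro conj_mult) auto
    then show ?case using generate.eng[OF eng.IH] by simp
  qed
  show ?thesis using g h
  proof (induction arbitrary: h)
    case one
    then show ?case using gT by simp
  next
    case (incl s)
    then show ?case using * by simp
  next
    case (inv s)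
    then show ?case using * S_inv by simp
  next
    case (eng g1 g2)
    have "g1 \<otimes> g2 \<otimes> h \<otimes> inv (g1 \<otimes> g2) = g1 \<otimes> (g2 \<otimes> h \<otimes> inv g2) \<otimes> inv g1"
      using eng gS gT by (intro conj_conj) auto
    then show ?case using eng by simp
  qed
qed

text \<open>One inclusion suffices for the finite sets considered. \<open>P\<close> is an arbitrary
  set: for a singleton this is a centralizer, and it is also applied to the set of row
  swaps.\<close>

definition normalizing :: "'a set \<Rightarrow> 'a set" where
  "normalizing P = {g \<in> carrier G. \<forall>x\<in>P. g \<otimes> x \<otimes> inv g \<in> P}"

text \<open>Conjugation by \<open>g\<close> is an injection of the finite set \<open>P\<close> into
  itself, hence onto.\<close>

lemma normalizing_inv_conj:
  assumes P: "P \<subseteq> carrier G" and fin: "finite P" and g: "g \<in> normalizing P" and x: "x \<in> P"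
  shows "inv g \<otimes> x \<otimes> g \<in> P"
proof -
  have gc: "g \<in> carrier G" and sub: "(\<lambda>x. g \<otimes> x \<otimes> inv g) ` P \<subseteq> P"
    using g by (auto simp: normalizing_def)
  have "inj_on (\<lambda>x. g \<otimes> x \<otimes> inv g) P"
    using P gc by (intro inj_onI) (simp add: subset_eq)
  then have "(\<lambda>x. g \<otimes> x \<otimes> inv g) ` P = P"
    using sub fin by (simp add: card_image card_subset_eq)
  then obtain y where y: "y \<in> P" "x = g \<otimes> y \<otimes> inv g"
    using x by blast
  have "inv g \<otimes> x \<otimes> g = y"
    using y(1) P gc unfolding y(2) by (simp add: m_assoc subset_eq inv_solve_left')
  then show ?thesis using y by simp
qed

lemma subgroup_normalizing:
  assumes P: "P \<subseteq> carrier G" and fin: "finite P"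
  shows "subgroup (normalizing P) G"
proof (rule subgroupI)
  show "normalizing P \<subseteq> carrier G" by (auto simp: normalizing_def)
  have "\<one> \<in> normalizing P" using P by (auto simp: normalizing_def)
  then show "normalizing P \<noteq> {}" by blast
next
  fix g assume g: "g \<in> normalizing P"
  then show "inv g \<in> normalizing P"
    using normalizing_inv_conj[OF P fin g] by (simp add: normalizing_def)
next
  fix g h assume gh: "g \<in> normalizing P" "h \<in> normalizing P"
  then have "g \<otimes> h \<otimes> x \<otimes> inv (g \<otimes> h) = g \<otimes> (h \<otimes> x \<otimes> inv h) \<otimes> inv g" if "x \<in> P" for x
    using that P by (intro conj_conj) (auto simp: normalizing_def)
  then show "g \<otimes> h \<in> normalizing P" using gh by (simp add: normalizing_def)
qed

lemma subgroup_subset_normalizing: "subgroup P G \<Longrightarrow> P \<subseteq> normalizing P"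
  by (auto simp: normalizing_def subgroup.m_closed subgroup.m_inv_closed subgroup.mem_carrier)

lemma card_rcosets_subgroup:
  assumes H: "subgroup H G" and K: "subgroup K G" "H \<subseteq> K"
  shows "card ((\<lambda>g. H #> g) ` K) * card H = card K"
proof -
  interpret K: group "G\<lparr>carrier := K\<rparr>"
    using K(1) by (rule subgroup_imp_group)
  have "subgroup H (G\<lparr>carrier := K\<rparr>)"
    using H K by (rule subgroup_incl)
  from K.lagrange[OF this]
  have "card (rcosets\<^bsub>G\<lparr>carrier := K\<rparr>\<^esub> H) * card H = card K"
    by (simp add: order_def)
  moreover have "rcosets\<^bsub>G\<lparr>carrier := K\<rparr>\<^esub> H = (\<lambda>g. H #> g) ` K"
    by (auto simp: RCOSETS_def r_coset_def)
  ultimately show ?thesis by simp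
qed

text \<open>\<open>P\<close> permutes its right cosets in \<open>K\<close>, and the coset of g is
  fixed exactly if g normalizes \<open>P\<close>. For a p-group \<open>K\<close> this makes
  normalizers grow; for the whole group it shows that \<open>P\<close> is Sylow as soon as it is
  Sylow in its normalizer.\<close>

lemma card_cosets_normalizing_mod:
  assumes p: "prime p" and P: "p_subgroup p G P"
    and K: "subgroup K G" "P \<subseteq> K" "finite K"
  shows "card ((\<lambda>g. P #> g) ` (K \<inter> normalizing P)) mod p = card ((\<lambda>g. P #> g) ` K) mod p"
proof -
  note sP = p_subgroupD[OF P]
  note Pc = subgroup.mem_carrier[OF sP]
  have sub: "P \<subseteq> carrier G" using sP by (rule subgroup.subset)
  have coset: "P #> g #> inv x = P #> (g \<otimes> inv x)" if "x \<in> P" "g \<in> carrier G" for x g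
    using that Pc sub by (simp add: coset_mult_assoc)
  \<comment> \<open>The inverse turns right multiplication into a left action.\<close>
  interpret F: finite_action G P "(\<lambda>g. P #> g) ` K" "\<lambda>x C. C #> inv x"
  proof (intro finite_action.intro finite_action_axioms.intro group_axioms)
    show "subgroup P G" "finite P" by (rule sP, rule p_subgroup_finite[OF p P])
    show "finite ((\<lambda>g. P #> g) ` K)" using K by simp
    show "C #> inv x \<in> (\<lambda>g. P #> g) ` K" if x: "x \<in> P" and C: "C \<in> (\<lambda>g. P #> g) ` K" for x C
    proof -
      obtain g where g: "g \<in> K" "C = P #> g" using C by blast
      then have "C #> inv x = P #> (g \<otimes> inv x)"
        using coset x subgroup.mem_carrier[OF K(1)] by simp
      moreover have "g \<otimes> inv x \<in> K"
        using g x K(2) subgroup.m_closed[OF K(1)] subgroup.m_inv_closed[OF K(1)] by blast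
      ultimately show ?thesis by blast
    qed
    show "C #> inv \<one> = C" if "C \<in> (\<lambda>g. P #> g) ` K" for C
    proof -
      have "C \<subseteq> carrier G" using that sub r_coset_subset_G subgroup.mem_carrier[OF K(1)] by auto
      then show ?thesis by (simp add: coset_mult_one)
    qed
    show "C #> inv (x \<otimes> y) = C #> inv y #> inv x"
      if xy: "x \<in> P" "y \<in> P" and C: "C \<in> (\<lambda>g. P #> g) ` K" for x y C
    proof -
      have "C \<subseteq> carrier G" using C sub r_coset_subset_G subgroup.mem_carrier[OF K(1)] by auto
      then show ?thesis using Pc xy by (simp add: coset_mult_assoc inv_mult_group)
    qed
  qed
  have "{C \<in> (\<lambda>g. P #> g) ` K. \<forall>x\<in>P. C #> inv x = C} = (\<lambda>g. P #> g) ` (K \<inter> normalizing P)"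
  proof -
    have fixed: "(\<forall>x\<in>P. P #> g #> inv x = P #> g) \<longleftrightarrow> g \<in> normalizing P" if g: "g \<in> carrier G" for g
    proof -
      have "P #> g #> inv x = P #> g \<longleftrightarrow> g \<otimes> inv x \<otimes> inv g \<in> P" if x: "x \<in> P" for x
      proof -
        have "g \<otimes> inv x \<otimes> inv g \<in> P \<longleftrightarrow> P #> (g \<otimes> inv x \<otimes> inv g) = P"
        proof
          assume "g \<otimes> inv x \<otimes> inv g \<in> P"
          then show "P #> (g \<otimes> inv x \<otimes> inv g) = P"
            using g Pc[OF x] sP by (intro coset_join2) simp_all
        next
          assume "P #> (g \<otimes> inv x \<otimes> inv g) = P"
          then show "g \<otimes> inv x \<otimes> inv g \<in> P"
            using g Pc[OF x] by (intro coset_join1[OF _ _ sP]) simp_all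
        qed
        also have "\<dots> \<longleftrightarrow> P #> (g \<otimes> inv x) = P #> g"
        proof
          assume "P #> (g \<otimes> inv x \<otimes> inv g) = P"
          then have "P #> (g \<otimes> inv x \<otimes> inv g) #> g = P #> g" by simp
          then show "P #> (g \<otimes> inv x) = P #> g"
            using g Pc[OF x] sub by (simp add: coset_mult_assoc m_assoc)
        next
          assume "P #> (g \<otimes> inv x) = P #> g"
          then have "P #> (g \<otimes> inv x) #> inv g = P #> g #> inv g" by simp
          then show "P #> (g \<otimes> inv x \<otimes> inv g) = P"
            using g Pc[OF x] sub by (simp add: coset_mult_assoc coset_mult_one)
        qed
        finally show ?thesis using coset[OF x g] by simp
      qed
      moreover have "(\<forall>x\<in>P. g \<otimes> inv x \<otimes> inv g \<in> P) \<longleftrightarrow> (\<forall>x\<in>P. g \<otimes> x \<otimes> inv g \<in> P)"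
      proof (intro iffI ballI)
        fix x assume x: "x \<in> P" and "\<forall>x\<in>P. g \<otimes> inv x \<otimes> inv g \<in> P"
        then have "g \<otimes> inv (inv x) \<otimes> inv g \<in> P" using subgroup.m_inv_closed[OF sP] by blast
        then show "g \<otimes> x \<otimes> inv g \<in> P" using Pc[OF x] by simp
      qed (use subgroup.m_inv_closed[OF sP] in blast)
      ultimately show ?thesis using g by (simp add: normalizing_def)
    qed
    have "K \<subseteq> carrier G" using K(1) by (rule subgroup.subset)
    then show ?thesis using fixed by blast
  qed
  with F.card_fixed_points_mod[OF p P] show ?thesis by simp
qed

end

section \<open>Sets of involutions with products of prime power order\<close>

text \<open>The index of \<open>U\<close> in its normalizer within \<open>K\<close> is congruent mod
  p to its index in \<open>K\<close>, a nontrivial power of p, and therefore cannot be 1.\<close>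

lemma (in group) normalizer_grows:
  assumes p: "prime p" and K: "p_subgroup p G K" and U: "subgroup U G" "U \<subset> K"
  shows "U \<subset> K \<inter> normalizing U"
proof -
  note sK = p_subgroupD[OF K]
  have fK: "finite K" by (rule p_subgroup_finite[OF p K])
  have pU: "p_subgroup p G U" using p_subgroup_mono[OF p K U(1)] U(2) by simp
  have fU: "finite U" by (rule p_subgroup_finite[OF p pU])
  have sub: "U \<subseteq> K \<inter> normalizing U"
    using U(2) subgroup_subset_normalizing[OF U(1)] by blast
  have sN: "subgroup (K \<inter> normalizing U) G"
    using sK subgroup_normalizing[OF subgroup.subset[OF U(1)] fU]
    by (rule subgroups_Inter_pair)
  let ?k = "card ((\<lambda>g. U #> g) ` K)"
  let ?n = "card ((\<lambda>g. U #> g) ` (K \<inter> normalizing U))"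
  have k: "?k * card U = card K"
    using U by (intro card_rcosets_subgroup sK) auto
  have n: "?n * card U = card (K \<inter> normalizing U)"
    using sub by (intro card_rcosets_subgroup sN U(1))
  obtain i where i: "card K = p ^ i" using K by (auto simp: p_subgroup_def)
  have "?k dvd p ^ i" using k i by (intro dvdI[of _ _ "card U"]) simp
  then obtain j where j: "?k = p ^ j" using divides_primepow_nat[OF p] by blast
  have "card U < card K" using U(2) fK by (rule psubset_card_mono[rotated])
  then have "j \<noteq> 0" using j k by (intro notI) simp
  then have "?k mod p = 0" using j by simp
  then have "?n mod p = 0"
    using card_cosets_normalizing_mod[OF p pU sK _ fK] U(2) by simp
  then have "?n \<noteq> 1" using prime_gt_1_nat[OF p] by (intro notI) simp
  then have "card (K \<inter> normalizing U) \<noteq> card U"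
    using n fU subgroup.one_closed[OF U(1)] by (intro notI) auto
  then show ?thesis using sub by auto
qed

lemma (in group) conj_nat_pow_of_inverted:
  assumes d: "d \<in> carrier G" and u: "u \<in> carrier G" and conj: "d \<otimes> u \<otimes> inv d = inv u"
  shows "d \<otimes> u [^] (i::nat) \<otimes> inv d = inv (u [^] i)"
proof (induction i)
  case 0
  then show ?case using d by simp
next
  case (Suc i)
  have "d \<otimes> u [^] Suc i \<otimes> inv d = (d \<otimes> u \<otimes> inv d) \<otimes> (d \<otimes> u [^] i \<otimes> inv d)"
    unfolding nat_pow_Suc2[OF u] using d u by (intro conj_mult) simp_all
  also have "\<dots> = inv u \<otimes> inv (u [^] i)" using Suc conj by simp
  also have "\<dots> = inv (u [^] Suc i)" using u by (simp add: inv_mult_group)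
  finally show ?case .
qed

text \<open>The model is the set of reflections of dihedral groups whose rotations d e are
  p-elements. Invariance of \<open>D\<close> under the whole group gives access to normalizers and
  conjugacy classes.\<close>

locale involution_set = group G for G (structure) +
  fixes D :: "'a set" and p :: nat
  assumes finite_carrier: "finite (carrier G)"
    and prime_p: "prime p"
    and D_subset: "D \<subseteq> carrier G"
    and D_square: "d \<in> D \<Longrightarrow> d \<otimes> d = \<one>"
    and D_conj: "\<lbrakk>g \<in> carrier G; d \<in> D\<rbrakk> \<Longrightarrow> g \<otimes> d \<otimes> inv g \<in> D"
    and D_pow: "\<lbrakk>d \<in> D; e \<in> D\<rbrakk> \<Longrightarrow> \<exists>k. (d \<otimes> e) [^] (p ^ k) = \<one>"
begin

lemma D_carrier: "d \<in> D \<Longrightarrow> d \<in> carrier G"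
  using D_subset by blast

lemma D_inv: "d \<in> D \<Longrightarrow> inv d = d"
  using D_square D_carrier by (simp add: inv_equality)

lemma D_cancel: "\<lbrakk>d \<in> D; x \<in> carrier G\<rbrakk> \<Longrightarrow> d \<otimes> (d \<otimes> x) = x"
  using D_square D_carrier by (simp flip: m_assoc)

lemma D_conj_product:
  assumes "d \<in> D" "e \<in> D"
  shows "d \<otimes> (d \<otimes> e) \<otimes> inv d = inv (d \<otimes> e)"
  using D_cancel[OF assms(1) D_carrier[OF assms(2)]] assms D_carrier D_inv by (simp add: inv_mult_group)

text \<open>Reflections in a dihedral group of odd degree are conjugate: \<open>d\<close> inverts a
  rotation q with q^2 = d e, so q^-1 d q = d q^2 = e. As q is a power of d e, it lies in every
  subgroup containing d e.\<close>

lemma conj_by_sqrt_product: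
  assumes odd: "odd p" and d: "d \<in> D" and e: "e \<in> D"
  obtains i :: nat where "inv ((d \<otimes> e) [^] i) \<otimes> d \<otimes> (d \<otimes> e) [^] i = e"
proof -
  note dc = D_carrier[OF d] and ec = D_carrier[OF e]
  define u where "u = d \<otimes> e"
  have uc: "u \<in> carrier G" using dc ec by (simp add: u_def)
  obtain k where k: "u [^] (p ^ k) = \<one>" using D_pow[OF d e] by (auto simp: u_def)
  \<comment> \<open>One half modulo p^k: twice this number is p^k + 1, so the i-th power squares to
    \<open>u\<close>.\<close>
  define i where "i = Suc (p ^ k) div 2"
  have "i + i = Suc (p ^ k)" using odd by (simp add: i_def flip: mult_2)
  define q where "q = u [^] i"
  have qc: "q \<in> carrier G" using uc by (simp add: q_def)
  have qq: "q \<otimes> q = u"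
    using uc k \<open>i + i = Suc (p ^ k)\<close> by (simp add: q_def nat_pow_mult)
  have "d \<otimes> u \<otimes> inv d = inv u" unfolding u_def by (rule D_conj_product[OF d e])
  then have "d \<otimes> q \<otimes> inv d = inv q"
    unfolding q_def by (rule conj_nat_pow_of_inverted[OF dc uc])
  then have "inv q \<otimes> d \<otimes> q = d \<otimes> q \<otimes> (inv d \<otimes> d) \<otimes> q"
    using dc qc by (metis inv_closed m_assoc m_closed)
  also have "\<dots> = d \<otimes> u" using qq dc qc by (simp add: m_assoc)
  also have "\<dots> = e" unfolding u_def by (rule D_cancel[OF d ec])
  finally show ?thesis
    using that[of i] by (simp add: q_def u_def)
qed

lemma finite_subgroup: "subgroup P G \<Longrightarrow> finite P"
  using finite_carrier subgroup.subset finite_subset by blast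

lemma subgroup_normalizer: "subgroup P G \<Longrightarrow> subgroup (normalizing P) G"
  using subgroup_normalizing subgroup.subset finite_subgroup by metis

text \<open>The rotations generated by d e form a p-group normalizing \<open>P\<close>, and
  \<open>d\<close> inverts them. Hence \<open>P\<close> times this rotation group is a p-group that
  \<open>d\<close> still normalizes, so the construction can be continued with
  \<open>d\<close>.\<close>

lemma adjoin_product:
  assumes P: "p_subgroup p G P" and d: "d \<in> D" "d \<in> normalizing P"
    and e: "e \<in> D" "e \<in> normalizing P"
  obtains P' where "p_subgroup p G P'" "P \<subseteq> P'" "d \<otimes> e \<in> P'" "d \<in> normalizing P'"
proof -
  note sP = p_subgroupD[OF P]
  note Pc = subgroup.mem_carrier[OF sP]
  note dc = D_carrier[OF d(1)] and ec = D_carrier[OF e(1)]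
  let ?u = "d \<otimes> e"
  define Z where "Z = generate G {?u}"
  have uc: "?u \<in> carrier G" using dc ec by simp
  obtain k where "?u [^] (p ^ k) = \<one>" using D_pow d e by blast
  then have Z: "p_subgroup p G Z"
    unfolding Z_def by (rule p_subgroup_generate_single[OF prime_p uc])
  note sZ = p_subgroupD[OF Z]
  have sN: "subgroup (normalizing P) G"
    by (rule subgroup_normalizer[OF sP])
  have "Z \<subseteq> normalizing P"
    unfolding Z_def using subgroup.m_closed[OF sN] d e
    by (intro generate_subgroup_incl[OF _ sN]) simp
  then have norm: "b \<otimes> a \<otimes> inv b \<in> P" if "a \<in> P" "b \<in> Z" for a b
    using that by (auto simp: normalizing_def)
  have "d \<otimes> ?u \<otimes> inv d = inv ?u"
    by (rule D_conj_product[OF d(1) e(1)])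
  then have du: "d \<otimes> ?u \<otimes> inv d \<in> Z"
    unfolding Z_def by (simp add: generate.inv)
  have conj: "d \<otimes> z \<otimes> inv d \<in> Z" if "z \<in> Z" for z
    unfolding Z_def
  proof (rule generate_conj[where S = "{d}"])
    show "z \<in> generate G {?u}" using that by (simp add: Z_def)
    show "d \<in> generate G {d}" by (rule generate.incl) simp
    show "{d} \<subseteq> carrier G" "{?u} \<subseteq> carrier G" using dc uc by simp_all
    show "inv g \<in> {d}" if "g \<in> {d}" for g using that d(1) D_inv by simp
    show "g \<otimes> h \<otimes> inv g \<in> generate G {?u}" if "g \<in> {d}" "h \<in> {?u}" for g h
      using that du by (simp add: Z_def)
  qed
  show ?thesis
  proof (rule that[of "P <#> Z"])
    show "p_subgroup p G (P <#> Z)"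
      by (rule p_subgroup_set_mult[OF prime_p P Z norm])
    show "P \<subseteq> P <#> Z" by (rule subgroup_set_mult(2)[OF sP sZ norm])
    have "?u \<in> Z" unfolding Z_def by (rule generate.incl) simp
    then show "?u \<in> P <#> Z" using subgroup_set_mult(3)[OF sP sZ norm] by blast
    have "d \<otimes> (x \<otimes> z) \<otimes> inv d \<in> P <#> Z" if x: "x \<in> P" and z: "z \<in> Z" for x z
    proof -
      have "d \<otimes> (x \<otimes> z) \<otimes> inv d = (d \<otimes> x \<otimes> inv d) \<otimes> (d \<otimes> z \<otimes> inv d)"
        using dc Pc[OF x] subgroup.mem_carrier[OF sZ z] by (rule conj_mult)
      moreover have "d \<otimes> x \<otimes> inv d \<in> P" using d x by (simp add: normalizing_def)
      ultimately show ?thesis using conj[OF z] by (auto simp: set_mult_def)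
    qed
    then show "d \<in> normalizing (P <#> Z)"
      using dc by (auto simp: normalizing_def set_mult_def)
  qed
qed

text \<open>The normalizer of \<open>R\<close> in \<open>P\<close> might grow without meeting
  \<open>D\<close> in anything new. So \<open>R\<close> is first replaced by a largest subgroup
  \<open>U\<close> of \<open>P\<close> with the same trace \<open>E\<close>; now the growth must
  produce a new element of \<open>D\<close>, and this element normalizes \<open>U\<close> and
  \<open>D\<close>, hence \<open>E\<close>.\<close>

lemma normalizing_element_of_larger:
  assumes P: "p_subgroup p G P" and R: "subgroup R G" "R \<subseteq> P"
    and E: "D \<inter> R = E" "E \<noteq> D \<inter> P"
  obtains e where "e \<in> D \<inter> P" "e \<notin> E" "\<And>x. x \<in> E \<Longrightarrow> e \<otimes> x \<otimes> inv e \<in> E"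
proof -
  let ?ok = "\<lambda>U. subgroup U G \<and> U \<subseteq> P \<and> D \<inter> U = E"
  have fP: "finite P" by (rule p_subgroup_finite[OF prime_p P])
  have "?ok R" using R E by simp
  moreover have "\<forall>U. ?ok U \<longrightarrow> card U < Suc (card P)"
    using fP by (auto intro: card_mono simp: less_Suc_eq_le)
  ultimately have "\<exists>U. ?ok U \<and> (\<forall>V. ?ok V \<longrightarrow> card V \<le> card U)"
    by (rule Lattices_Big.ex_has_greatest_nat)
  then obtain U where U: "?ok U" and max: "\<And>V. ?ok V \<Longrightarrow> card V \<le> card U"
    by blast
  have "U \<subset> P" using U E by blast
  then have grow: "U \<subset> P \<inter> normalizing U"
    using U by (intro normalizer_grows[OF prime_p P]) simp_all
  have "subgroup (P \<inter> normalizing U) G"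
    using p_subgroupD[OF P] subgroup_normalizer U by (intro subgroups_Inter_pair) simp_all
  moreover have "card U < card (P \<inter> normalizing U)"
    using grow fP by (intro psubset_card_mono) simp_all
  ultimately have "D \<inter> (P \<inter> normalizing U) \<noteq> E"
    using max[of "P \<inter> normalizing U"] by auto
  then obtain e where e: "e \<in> D" "e \<in> P" "e \<in> normalizing U" "e \<notin> E"
    using grow U by blast
  show ?thesis
  proof (rule that[of e])
    fix x assume "x \<in> E"
    then have "x \<in> D" "x \<in> U" using U by auto
    then have "e \<otimes> x \<otimes> inv e \<in> D \<inter> U"
      using D_conj[OF D_carrier] e by (simp add: normalizing_def)
    then show "e \<otimes> x \<otimes> inv e \<in> E" using U by simp
  qed (use e in auto)
qed

text \<open>The Baer--Suzuki argument: two maximal traces of 2-subgroups on \<open>D\<close> with largest intersection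
  can be enlarged simultaneously, since two involutions normalizing the intersection generate a
  dihedral 2-group.\<close>

lemma two_subgroup_containing:
  assumes p2: "p = 2"
  obtains P where "p_subgroup p G P" "D \<subseteq> P"
proof -
  \<comment> \<open>Maximality refers to traces on \<open>D\<close>, since different p-subgroups can
    contain the same involutions.\<close>
  define M where "M = {D \<inter> P | P. p_subgroup p G P}"
  define Mx where "Mx = {A \<in> M. \<forall>B\<in>M. A \<subseteq> B \<longrightarrow> A = B}"
  have fD: "finite D" using D_subset finite_carrier by (rule finite_subset)
  have fM: "finite M"
    by (rule finite_subset[of _ "Pow D"]) (use fD in \<open>auto simp: M_def\<close>)
  have ext: "\<exists>B\<in>Mx. A \<subseteq> B" if "A \<in> M" for A
    using finite_has_maximal2[OF fM that] by (auto simp: Mx_def)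
  have single: "p_subgroup p G (generate G {e})" "e \<in> generate G {e}" if "e \<in> D" for e
  proof -
    have "e [^] (2::nat) = \<one>" using that D_carrier D_square by (simp add: numeral_2_eq_2)
    then show "p_subgroup p G (generate G {e})"
      using that D_carrier p2 by (intro p_subgroup_generate_single[OF prime_p, where k = 1]) simp_all
  qed (simp add: generate.incl)
  have unique: "A = B" if A: "A \<in> Mx" and B: "B \<in> Mx" for A B
  proof (rule ccontr)
    assume "A \<noteq> B"
    let ?ok = "\<lambda>(A, B). A \<in> Mx \<and> B \<in> Mx \<and> A \<noteq> B"
    have "?ok (A, B)" using A B \<open>A \<noteq> B\<close> by simp
    moreover have "\<forall>X. ?ok X \<longrightarrow> card (fst X \<inter> snd X) < Suc (card D)"
      using fD by (auto simp: less_Suc_eq_le Mx_def M_def intro!: card_mono)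
    ultimately have "\<exists>X. ?ok X \<and> (\<forall>Y. ?ok Y \<longrightarrow> card (fst Y \<inter> snd Y) \<le> card (fst X \<inter> snd X))"
      by (rule Lattices_Big.ex_has_greatest_nat)
    then obtain A1 A2 where A12: "A1 \<in> Mx" "A2 \<in> Mx" "A1 \<noteq> A2"
      and max: "\<And>B1 B2. \<lbrakk>B1 \<in> Mx; B2 \<in> Mx; B1 \<noteq> B2\<rbrakk> \<Longrightarrow> card (B1 \<inter> B2) \<le> card (A1 \<inter> A2)"
      by auto
    obtain P1 P2 where P1: "p_subgroup p G P1" "A1 = D \<inter> P1" and P2: "p_subgroup p G P2" "A2 = D \<inter> P2"
      using A12 by (auto simp: Mx_def M_def)
    define E where "E = A1 \<inter> A2"
    have sR: "subgroup (P1 \<inter> P2) G"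
      using P1 P2 by (intro subgroups_Inter_pair p_subgroupD)
    have ER: "D \<inter> (P1 \<inter> P2) = E" using P1 P2 by (auto simp: E_def)
    have E1: "E \<noteq> D \<inter> P1" and E2: "E \<noteq> D \<inter> P2"
      using A12 unfolding P1(2)[symmetric] P2(2)[symmetric] E_def Mx_def by blast+
    obtain e1 where e1: "e1 \<in> D \<inter> P1" "e1 \<notin> E" "\<And>x. x \<in> E \<Longrightarrow> e1 \<otimes> x \<otimes> inv e1 \<in> E"
      using normalizing_element_of_larger[OF P1(1) sR _ ER E1] by blast
    obtain e2 where e2: "e2 \<in> D \<inter> P2" "e2 \<notin> E" "\<And>x. x \<in> E \<Longrightarrow> e2 \<otimes> x \<otimes> inv e2 \<in> E"
      using normalizing_element_of_larger[OF P2(1) sR _ ER E2] by blast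
    have Ec: "E \<subseteq> carrier G" using ER D_subset by blast
    \<comment> \<open>The involutions \<open>e1\<close> and \<open>e2\<close> are only known to
      preserve the trace \<open>E\<close>, not the intersection of \<open>P1\<close> and
      \<open>P2\<close>. Thus the group to be enlarged is the one generated by
      \<open>E\<close>.\<close>
    define P0 where "P0 = generate G E"
    have P0: "p_subgroup p G P0"
      unfolding P0_def
      by (rule p_subgroup_mono[OF prime_p P1(1) generate_is_subgroup[OF Ec]],
          rule generate_subgroup_incl[OF _ p_subgroupD[OF P1(1)]])
        (use ER in blast)
    have norm: "e \<in> normalizing P0" if "e \<in> D" "\<And>x. x \<in> E \<Longrightarrow> e \<otimes> x \<otimes> inv e \<in> E" for e
    proof -
      have "e \<otimes> x \<otimes> inv e \<in> generate G E" if "x \<in> generate G E" for x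
      proof (rule generate_conj[where S = "{e}", OF _ Ec _ _ _ that])
        show "e \<in> generate G {e}" by (rule generate.incl) simp
        show "{e} \<subseteq> carrier G" using \<open>e \<in> D\<close> D_carrier by simp
        show "inv g \<in> {e}" if "g \<in> {e}" for g using that \<open>e \<in> D\<close> D_inv by simp
        show "g \<otimes> h \<otimes> inv g \<in> generate G E" if "g \<in> {e}" "h \<in> E" for g h
          using that \<open>\<And>x. x \<in> E \<Longrightarrow> e \<otimes> x \<otimes> inv e \<in> E\<close> by (simp add: generate.incl)
      qed
      then show ?thesis using \<open>e \<in> D\<close> D_carrier by (simp add: normalizing_def P0_def)
    qed
    obtain P' where P': "p_subgroup p G P'" "P0 \<subseteq> P'" "e1 \<otimes> e2 \<in> P'" "e1 \<in> normalizing P'"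
      using adjoin_product[OF P0, of e1 e2] norm e1 e2 by blast
    \<comment> \<open>Here p = 2 enters: \<open>e1\<close> is a p-element and can be adjoined to the
      rotations, which also brings in e2 = e1 (e1 e2).\<close>
    define Z where "Z = generate G {e1}"
    have Z: "p_subgroup p G Z" "e1 \<in> Z" using single e1 by (auto simp: Z_def)
    have sN: "subgroup (normalizing P') G"
      by (rule subgroup_normalizer[OF p_subgroupD[OF P'(1)]])
    have "Z \<subseteq> normalizing P'"
      unfolding Z_def using P'(4) by (intro generate_subgroup_incl[OF _ sN]) simp
    then have nZ: "b \<otimes> a \<otimes> inv b \<in> P'" if "a \<in> P'" "b \<in> Z" for a b
      using that by (auto simp: normalizing_def)
    note sPZ = subgroup_set_mult[OF p_subgroupD[OF P'(1)] p_subgroupD[OF Z(1)] nZ]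
    have PZ: "p_subgroup p G (P' <#> Z)"
      by (rule p_subgroup_set_mult[OF prime_p P'(1) Z(1) nZ])
    then have "D \<inter> (P' <#> Z) \<in> M" by (auto simp: M_def)
    then obtain C where C: "C \<in> Mx" "D \<inter> (P' <#> Z) \<subseteq> C" using ext by blast
    have in1: "e1 \<in> P' <#> Z" using sPZ(3) Z(2) by blast
    have "e1 \<otimes> (e1 \<otimes> e2) \<in> P' <#> Z"
      using in1 P'(3) sPZ(2) by (blast intro: subgroup.m_closed[OF sPZ(1)])
    moreover have "e1 \<otimes> (e1 \<otimes> e2) = e2" using e1 e2 by (intro D_cancel D_carrier) simp_all
    ultimately have in2: "e2 \<in> P' <#> Z" by simp
    have "E \<subseteq> P0" unfolding P0_def by (auto intro: generate.incl)
    then have "E \<subseteq> C" using C(2) P'(2) sPZ(2) ER by blast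
    \<comment> \<open>If \<open>C\<close> differed from \<open>A1\<close>, these maximal traces
      would share \<open>E\<close> and also \<open>e1\<close>, more than the largest possible
      intersection. The same holds for \<open>A2\<close> with \<open>e2\<close>.\<close>
    have "C = A1"
    proof (rule ccontr)
      assume "C \<noteq> A1"
      then have "card (C \<inter> A1) \<le> card E" using max C(1) A12(1) unfolding E_def by blast
      moreover have "insert e1 E \<subseteq> C \<inter> A1"
        using \<open>E \<subseteq> C\<close> e1 in1 C(2) P1(2) E_def by blast
      then have "card (insert e1 E) \<le> card (C \<inter> A1)"
        using fD P1(2) by (intro card_mono) auto
      ultimately show False
        using e1 fD finite_subset[of E D] ER by auto
    qed
    moreover have "C = A2"
    proof (rule ccontr)
      assume "C \<noteq> A2"
      then have "card (C \<inter> A2) \<le> card E" using max C(1) A12(2) unfolding E_def by blast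
      moreover have "insert e2 E \<subseteq> C \<inter> A2"
        using \<open>E \<subseteq> C\<close> e2 in2 C(2) P2(2) E_def by blast
      then have "card (insert e2 E) \<le> card (C \<inter> A2)"
        using fD P2(2) by (intro card_mono) auto
      ultimately show False
        using e2 fD finite_subset[of E D] ER by auto
    qed
    ultimately show False using A12(3) by simp
  qed
  have "subgroup {\<one>} G" by (rule triv_subgroup)
  moreover have "card {\<one>} = p ^ 0" by simp
  ultimately have "p_subgroup p G {\<one>}" unfolding p_subgroup_def by blast
  then have "D \<inter> {\<one>} \<in> M" by (auto simp: M_def)
  then obtain A where A: "A \<in> Mx" using ext by blast
  \<comment> \<open>Each involution lies in the 2-group it generates, hence in some maximal trace,
    and there is only one.\<close>
  have "D \<subseteq> A"
  proof
    fix e assume e: "e \<in> D"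
    have "D \<inter> generate G {e} \<in> M" using single(1)[OF e] by (auto simp: M_def)
    then obtain B where "B \<in> Mx" "D \<inter> generate G {e} \<subseteq> B" using ext by blast
    then show "e \<in> A" using unique[OF A] single(2)[OF e] e by blast
  qed
  then show ?thesis using A that by (auto simp: Mx_def M_def)
qed

text \<open>If \<open>P\<close> is maximal among the \<open>p\<close>-subgroups that are normalized by \<open>d\<close> and contain a Sylow
  subgroup of the centralizer \<open>C\<close> of \<open>d\<close>, then \<open>d\<close> is central in \<open>N(P)/P\<close>, and extracting square
  roots gives \<open>N(P) = P (C \<inter> N(P))\<close>. Hence \<open>P\<close> is a Sylow subgroup, and the whole group is
  \<open>P C\<close> because \<open>C\<close> has \<open>p\<close>-power index.\<close>

lemma p_subgroup_containing_products_odd: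
  assumes odd: "odd p" and card_D: "card D = p ^ n"
  obtains P where "p_subgroup p G P" "\<And>d e. \<lbrakk>d \<in> D; e \<in> D\<rbrakk> \<Longrightarrow> d \<otimes> e \<in> P"
proof -
  have "card D \<noteq> 0" using card_D prime_gt_0_nat[OF prime_p] by simp
  then obtain d where d: "d \<in> D" by fastforce
  have dc: "d \<in> carrier G" by (rule D_carrier[OF d])
  have trans: "\<exists>g\<in>carrier G. e = g \<otimes> d \<otimes> inv g" if e: "e \<in> D" for e
  proof -
    obtain i :: nat where "inv ((d \<otimes> e) [^] i) \<otimes> d \<otimes> (d \<otimes> e) [^] i = e"
      using conj_by_sqrt_product[OF odd d e] by blast
    then show ?thesis
      using dc D_carrier[OF e] by (intro bexI[of _ "inv ((d \<otimes> e) [^] i)"]) simp_all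
  qed
  define C where "C = {g \<in> carrier G. g \<otimes> d \<otimes> inv g = d}"
  have "C = normalizing {d}" by (simp add: C_def normalizing_def)
  then have sC: "subgroup C G" using subgroup_normalizing[of "{d}"] dc by simp
  have fC: "finite C" by (rule finite_subgroup[OF sC])
  have card_C: "card D * card C = order G"
  proof -
    interpret F: finite_action G "carrier G" D "\<lambda>g e. g \<otimes> e \<otimes> inv g"
    proof (intro finite_action.intro finite_action_axioms.intro group_axioms)
      show "subgroup (carrier G) G" by (rule subgroup_self)
      show "finite D" using D_subset finite_carrier by (rule finite_subset)
      show "\<one> \<otimes> e \<otimes> inv \<one> = e" if "e \<in> D" for e using that D_carrier by simp
    qed (use finite_carrier D_conj conj_conj D_carrier in simp_all)
    have "{g \<otimes> d \<otimes> inv g | g. g \<in> carrier G} = D"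
      using trans D_conj[OF _ d] by blast
    then show ?thesis using F.orbit_stabilizer[OF d] by (simp add: C_def order_def)
  qed
  have "card C \<noteq> 0" using fC subgroup.one_closed[OF sC] by auto
  then obtain a m where m: "card C = p ^ a * m" "\<not> p dvd m"
    using multiplicity_decompose'[of "card C" p] prime_p not_prime_unit by metis
  interpret C: group "G\<lparr>carrier := C\<rparr>" using sC by (rule subgroup_imp_group)
  obtain T where T: "subgroup T (G\<lparr>carrier := C\<rparr>)" "card T = p ^ a"
    using sylow_thm[OF prime_p C.is_group, of a m] m(1) fC by (auto simp: order_def)
  have sT: "subgroup T G" by (rule incl_subgroup[OF sC T(1)])
  have TC: "T \<subseteq> C" using subgroup.subset[OF T(1)] by simp
  have Cd: "d \<otimes> t \<otimes> inv d = t" if "t \<in> C" for t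
  proof -
    have t: "t \<in> carrier G" "t \<otimes> d \<otimes> inv t = d" using that by (auto simp: C_def)
    then have "t \<otimes> d = d \<otimes> t" using dc by (metis inv_solve_right m_closed)
    then show ?thesis using dc t by (simp add: inv_solve_right')
  qed
  \<comment> \<open>Normalization by \<open>d\<close> is part of the condition so that
    \<open>adjoin_product\<close> applies to \<open>P\<close> and any competitor it produces is
    again admissible.\<close>
  let ?ok = "\<lambda>P. p_subgroup p G P \<and> T \<subseteq> P \<and> d \<in> normalizing P"
  have "d \<in> normalizing T" using Cd TC dc by (auto simp: normalizing_def subset_eq)
  then have "?ok T" using sT T(2) by (auto simp: p_subgroup_def)
  moreover have "\<forall>P. ?ok P \<longrightarrow> card P < Suc (order G)"
    using finite_carrier
    by (auto simp: less_Suc_eq_le order_def p_subgroup_def intro!: card_mono subgroup.subset)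
  ultimately have "\<exists>P. ?ok P \<and> (\<forall>P'. ?ok P' \<longrightarrow> card P' \<le> card P)"
    by (rule Lattices_Big.ex_has_greatest_nat)
  then obtain P where P: "p_subgroup p G P" "T \<subseteq> P" "d \<in> normalizing P"
    and max: "\<And>P'. ?ok P' \<Longrightarrow> card P' \<le> card P" by blast
  note sP = p_subgroupD[OF P(1)]
  note Pc = subgroup.mem_carrier[OF sP]
  define N where "N = normalizing P"
  have sN: "subgroup N G" unfolding N_def by (rule subgroup_normalizer[OF sP])
  have PN: "P \<subseteq> N" unfolding N_def by (rule subgroup_subset_normalizing[OF sP])
  have central: "d \<otimes> e \<in> P" if e: "e \<in> D" "e \<in> N" for e
  proof -
    obtain P' where P': "p_subgroup p G P'" "P \<subseteq> P'" "d \<otimes> e \<in> P'" "d \<in> normalizing P'"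
      using adjoin_product[OF P(1) d P(3) e(1)] e(2) unfolding N_def by blast
    then have "card P' \<le> card P" using P(2) by (intro max) auto
    then have "P = P'"
      using P'(2) finite_subgroup[OF p_subgroupD[OF P'(1)]] by (intro card_seteq) auto
    then show ?thesis using P'(3) by simp
  qed
  \<comment> \<open>The element g moves \<open>d\<close> to \<open>e\<close>; the square root q of d
    e moves it back and lies in \<open>P\<close>, being a power of an element of
    \<open>P\<close>.\<close>
  have root: "\<exists>q\<in>P. q \<otimes> g \<in> C" if g: "g \<in> N" for g
  proof -
    have gc: "g \<in> carrier G" by (rule subgroup.mem_carrier[OF sN g])
    define e where "e = g \<otimes> d \<otimes> inv g"
    have e: "e \<in> D" unfolding e_def by (rule D_conj[OF gc d])
    have ec: "e \<in> carrier G" by (rule D_carrier[OF e])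
    have "e \<in> N" unfolding e_def
      using g P(3) subgroup.m_closed[OF sN] subgroup.m_inv_closed[OF sN] by (simp add: N_def)
    define u where "u = d \<otimes> e"
    have uP: "u \<in> P" unfolding u_def by (rule central[OF e \<open>e \<in> N\<close>])
    have uc: "u \<in> carrier G" by (rule Pc[OF uP])
    obtain i where i: "inv (u [^] (i::nat)) \<otimes> d \<otimes> u [^] i = e"
      using conj_by_sqrt_product[OF odd d e] unfolding u_def by blast
    define q where "q = u [^] i"
    have qc: "q \<in> carrier G" using uc by (simp add: q_def)
    have "q \<in> generate G {u}"
      unfolding q_def using uc generate_pow[OF uc] by (metis (mono_tags, lifting) UNIV_I int_pow_int mem_Collect_eq)
    then have qP: "q \<in> P"
      using generate_subgroup_incl[OF _ sP, of "{u}"] uP by blast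
    have e_eq: "e = inv q \<otimes> d \<otimes> q" using i by (simp add: q_def)
    have "q \<otimes> g \<otimes> d \<otimes> inv (q \<otimes> g) = q \<otimes> e \<otimes> inv q"
      unfolding e_def using qc gc dc by (intro conj_conj)
    also have "\<dots> = (q \<otimes> inv q) \<otimes> d \<otimes> (q \<otimes> inv q)"
      unfolding e_eq using qc dc by (simp only: m_assoc m_closed inv_closed)
    also have "\<dots> = d" using qc dc by simp
    finally have "q \<otimes> g \<in> C" using qc gc by (simp add: C_def)
    then show ?thesis using qP by blast
  qed
  have sPC: "subgroup (P \<inter> C) G" using sP sC by (rule subgroups_Inter_pair)
  \<comment> \<open>A p-subgroup of \<open>C\<close> that contains the Sylow subgroup
    \<open>T\<close> has the order of \<open>T\<close>.\<close>
  have card_PC: "card (P \<inter> C) = p ^ a"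
  proof -
    have "p_subgroup p G (P \<inter> C)" by (rule p_subgroup_mono[OF prime_p P(1) sPC]) simp
    then obtain j where j: "card (P \<inter> C) = p ^ j" by (auto simp: p_subgroup_def)
    have "p ^ a dvd p ^ j"
      using card_subgroup_dvd[OF sT sPC] TC P(2) T(2) j by simp
    then have "a \<le> j" using prime_gt_1_nat[OF prime_p] by (simp add: dvd_power_iff_le)
    then obtain l where l: "j = a + l" using le_Suc_ex by blast
    have "p ^ j dvd p ^ a * m"
      using card_subgroup_dvd[OF sPC sC] m(1) j by simp
    then have "p ^ l dvd m" using prime_gt_0_nat[OF prime_p] by (simp add: l power_add)
    then have "l = 0" using m(2) by (cases l) (auto dest: dvd_mult_left)
    then show ?thesis using j l by simp
  qed
  have sCN: "subgroup (C \<inter> N) G" using sC sN by (rule subgroups_Inter_pair)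
  have "P <#> (C \<inter> N) = N"
  proof
    show "P <#> (C \<inter> N) \<subseteq> N"
      using PN subgroup.m_closed[OF sN] by (auto simp: set_mult_def)
    show "N \<subseteq> P <#> (C \<inter> N)"
    proof
      fix g assume g: "g \<in> N"
      then obtain q where q: "q \<in> P" "q \<otimes> g \<in> C" using root by blast
      have "q \<otimes> g \<in> N" using q g PN subgroup.m_closed[OF sN] by blast
      moreover have "g = inv q \<otimes> (q \<otimes> g)"
        using Pc[OF q(1)] subgroup.mem_carrier[OF sN g] by (simp flip: m_assoc)
      ultimately show "g \<in> P <#> (C \<inter> N)"
        using q subgroup.m_inv_closed[OF sP] unfolding set_mult_def by blast
    qed
  qed
  moreover have "P \<inter> (C \<inter> N) = P \<inter> C" using PN by blast
  ultimately have card_N: "card N * p ^ a = card P * card (C \<inter> N)"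
    using card_set_mult[OF sP sCN finite_subgroup[OF sP] finite_subgroup[OF sCN]] card_PC by simp
  have "p ^ a dvd card (C \<inter> N)"
    using card_subgroup_dvd[OF sPC sCN] PN card_PC by auto
  then obtain m1 where m1: "card (C \<inter> N) = p ^ a * m1" by (rule dvdE)
  have "p ^ a * m1 dvd p ^ a * m"
    using card_subgroup_dvd[OF sCN sC] m1 m(1) by simp
  then have "m1 dvd m" using prime_gt_0_nat[OF prime_p] by simp
  then have "\<not> p dvd m1" using m(2) dvd_trans by blast
  have card_P0: "card P \<noteq> 0" using finite_subgroup[OF sP] subgroup.one_closed[OF sP] by auto
  have "card N = card P * m1" using card_N m1 prime_gt_0_nat[OF prime_p] by simp
  moreover have "card ((\<lambda>g. P #> g) ` N) * card P = card N"
    by (rule card_rcosets_subgroup[OF sP sN PN])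
  ultimately have cosets_N: "card ((\<lambda>g. P #> g) ` N) = m1" using card_P0 by simp
  define M where "M = card ((\<lambda>g. P #> g) ` carrier G)"
  have M: "M * card P = order G"
    unfolding M_def order_def
    by (rule card_rcosets_subgroup[OF sP subgroup_self subgroup.subset[OF sP]])
  have "carrier G \<inter> N = N" using subgroup.subset[OF sN] by blast
  \<comment> \<open>The index of \<open>P\<close> in its normalizer is prime to p, so its index
    \<open>M\<close> in the whole group is prime to p as well.\<close>
  then have "m1 mod p = M mod p"
    using card_cosets_normalizing_mod[OF prime_p P(1) subgroup_self subgroup.subset[OF sP] finite_carrier]
      cosets_N unfolding M_def N_def by simp
  then have M_not: "\<not> p dvd M" using \<open>\<not> p dvd m1\<close> by (simp add: dvd_eq_mod_eq_0)
  obtain b where b: "card P = p ^ b" using P(1) by (auto simp: p_subgroup_def)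
  \<comment> \<open>Two factorizations of the group order, one through \<open>P\<close> and one
    through \<open>C\<close>, are compared in their p-parts.\<close>
  have "M * p ^ b = m * p ^ (n + a)"
    using M b card_C card_D m(1) by (simp add: power_add mult_ac)
  then have b_eq: "b = n + a" by (rule prime_power_cancel[OF prime_p _ M_not m(2)])
  have "card (P <#> C) * p ^ a = p ^ b * (p ^ a * m)"
    using card_set_mult[OF sP sC finite_subgroup[OF sP] fC] card_PC b m(1) by simp
  then have "card (P <#> C) = p ^ n * (p ^ a * m)"
    using prime_gt_0_nat[OF prime_p] by (simp add: b_eq power_add)
  then have "card (P <#> C) = card (carrier G)"
    using card_C card_D m(1) by (simp add: order_def)
  then have PC: "P <#> C = carrier G"
    using setmult_subset_G[OF subgroup.subset[OF sP] subgroup.subset[OF sC]] finite_carrier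
    by (intro card_subset_eq)
  \<comment> \<open>Since \<open>C\<close> fixes \<open>d\<close>, every conjugate of
    \<open>d\<close> is already a conjugate by some q in \<open>P\<close>. Then d e is the
    commutator d q d^-1 q^-1, which stays in \<open>P\<close> because \<open>d\<close> normalizes
    \<open>P\<close>.\<close>
  have prod: "d \<otimes> e \<in> P" if e: "e \<in> D" for e
  proof -
    obtain g where g: "g \<in> carrier G" "e = g \<otimes> d \<otimes> inv g" using trans[OF e] by blast
    obtain q c where qc: "q \<in> P" "c \<in> C" "g = q \<otimes> c"
      using g(1) unfolding PC[symmetric] set_mult_def by blast
    note qcc = Pc[OF qc(1)] subgroup.mem_carrier[OF sC qc(2)]
    have "e = q \<otimes> (c \<otimes> d \<otimes> inv c) \<otimes> inv q"
      unfolding g(2) qc(3) using qcc dc by (intro conj_conj)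
    also have "c \<otimes> d \<otimes> inv c = d" using qc(2) by (simp add: C_def)
    finally have "d \<otimes> e = (d \<otimes> q \<otimes> inv d) \<otimes> inv q"
      using qcc dc D_inv[OF d] by (simp add: m_assoc)
    moreover have "d \<otimes> q \<otimes> inv d \<in> P" using P(3) qc(1) by (simp add: normalizing_def)
    ultimately show ?thesis
      using qc(1) subgroup.m_closed[OF sP] subgroup.m_inv_closed[OF sP] by simp
  qed
  show ?thesis
  proof (rule that[OF P(1)])
    fix d' e assume d': "d' \<in> D" and e: "e \<in> D"
    have "inv (d \<otimes> d') \<otimes> (d \<otimes> e) = d' \<otimes> (d \<otimes> (d \<otimes> e))"
      using d d' e D_carrier D_inv by (simp add: inv_mult_group m_assoc)
    also have "\<dots> = d' \<otimes> e" using D_cancel[OF d D_carrier[OF e]] by simp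
    finally show "d' \<otimes> e \<in> P"
      using prod[OF d'] prod[OF e] subgroup.m_closed[OF sP] subgroup.m_inv_closed[OF sP] by metis
  qed
qed

end

section \<open>Moufang loops\<close>

context loop
begin

lemma loop_l_cancel:
  "\<lbrakk>a \<in> carrier Q; x \<in> carrier Q; y \<in> carrier Q\<rbrakk> \<Longrightarrow> a \<otimes> x = a \<otimes> y \<longleftrightarrow> x = y"
  using left_division[of a "a \<otimes> y"] mult_closed by blast

lemma loop_r_cancel:
  "\<lbrakk>a \<in> carrier Q; x \<in> carrier Q; y \<in> carrier Q\<rbrakk> \<Longrightarrow> x \<otimes> a = y \<otimes> a \<longleftrightarrow> x = y"
  using right_division[of a "y \<otimes> a"] mult_closed by blast

end

context moufang_loop
begin

lemma flexible:
  "\<lbrakk>x \<in> carrier Q; y \<in> carrier Q\<rbrakk> \<Longrightarrow> (x \<otimes> y) \<otimes> x = x \<otimes> (y \<otimes> x)"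
  using moufang[of x y \<one>] by (simp add: one_closed right_one mult_closed)

text \<open>For a right inverse y of x the Moufang identity collapses to x (y (x z)) = x z.
  Cancelling x shows that y undoes left multiplication by x; z = 1 makes y two-sided.\<close>

lemma ex_inverse:
  assumes x: "x \<in> carrier Q"
  obtains y where "y \<in> carrier Q" "x \<otimes> y = \<one>" "y \<otimes> x = \<one>"
    "\<And>z. z \<in> carrier Q \<Longrightarrow> y \<otimes> (x \<otimes> z) = z"
proof -
  obtain y where y: "y \<in> carrier Q" "x \<otimes> y = \<one>"
    using left_division[OF x one_closed] by blast
  have cancel: "y \<otimes> (x \<otimes> z) = z" if z: "z \<in> carrier Q" for z
  proof -
    have "x \<otimes> (y \<otimes> (x \<otimes> z)) = x \<otimes> z"
      using moufang[OF x y(1) z] y(2) x z by (simp add: left_one)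
    then show ?thesis using x y z by (simp add: loop_l_cancel mult_closed)
  qed
  moreover have "y \<otimes> x = \<one>" using cancel[OF one_closed] x by (simp add: right_one)
  ultimately show ?thesis using y that by blast
qed

text \<open>\<open>inv\<close> is a definite description of a two-sided inverse, so uniqueness has
  to be settled before anything can be said about it.\<close>

lemma inverse_props:
  assumes x: "x \<in> carrier Q"
  shows inverse_closed: "inv x \<in> carrier Q"
    and r_inverse: "x \<otimes> inv x = \<one>"
    and l_inverse: "inv x \<otimes> x = \<one>"
    and inverse_l_cancel: "z \<in> carrier Q \<Longrightarrow> inv x \<otimes> (x \<otimes> z) = z"
proof -
  obtain y where y: "y \<in> carrier Q" "x \<otimes> y = \<one>" "y \<otimes> x = \<one>"
    "\<And>z. z \<in> carrier Q \<Longrightarrow> y \<otimes> (x \<otimes> z) = z"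
    using ex_inverse[OF x] by blast
  have "inv x = y"
    unfolding m_inv_def
  proof (rule the_equality)
    show "w = y" if "w \<in> carrier Q \<and> x \<otimes> w = \<one> \<and> w \<otimes> x = \<one>" for w
      using that y x loop_l_cancel[of x w y] by simp
  qed (use y in simp)
  then show "inv x \<in> carrier Q" "x \<otimes> inv x = \<one>" "inv x \<otimes> x = \<one>"
    "z \<in> carrier Q \<Longrightarrow> inv x \<otimes> (x \<otimes> z) = z"
    using y by simp_all
qed

lemma inverse_inverse: "x \<in> carrier Q \<Longrightarrow> inv (inv x) = x"
  using loop_l_cancel[of "inv x" "inv (inv x)" x] by (simp add: inverse_props)

lemma l_cancel_inverse: "\<lbrakk>x \<in> carrier Q; z \<in> carrier Q\<rbrakk> \<Longrightarrow> x \<otimes> (inv x \<otimes> z) = z"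
  using inverse_l_cancel[of "inv x" z] by (simp add: inverse_props inverse_inverse)

text \<open>Substituting x^-1 y for y removes the leading x on the left; the instance z = x^-1 then
  gives the right inverse property.\<close>

lemma moufang_shifted:
  assumes "x \<in> carrier Q" "y \<in> carrier Q" "z \<in> carrier Q"
  shows "(y \<otimes> x) \<otimes> z = x \<otimes> ((inv x \<otimes> y) \<otimes> (x \<otimes> z))"
  using moufang[of x "inv x \<otimes> y" z] assms
  by (simp add: inverse_closed mult_closed l_cancel_inverse)

lemma r_cancel_inverse:
  assumes "x \<in> carrier Q" "y \<in> carrier Q"
  shows "(y \<otimes> x) \<otimes> inv x = y"
  using moufang_shifted[of x y "inv x"] assms
  by (simp add: inverse_closed mult_closed l_cancel_inverse r_inverse right_one)

lemma inverse_r_cancel: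
  assumes "x \<in> carrier Q" "y \<in> carrier Q"
  shows "(y \<otimes> inv x) \<otimes> x = y"
  using r_cancel_inverse[of "inv x" y] assms by (simp add: inverse_closed inverse_inverse)

lemma inverse_mult:
  assumes x: "x \<in> carrier Q" and y: "y \<in> carrier Q"
  shows "inv (x \<otimes> y) = inv y \<otimes> inv x"
proof -
  have "inv (x \<otimes> y) \<otimes> x = inv (x \<otimes> y) \<otimes> ((x \<otimes> y) \<otimes> inv y)"
    using x y by (simp add: r_cancel_inverse)
  also have "\<dots> = inv y"
    using x y by (simp add: inverse_l_cancel mult_closed inverse_closed)
  finally have "inv (x \<otimes> y) \<otimes> x \<otimes> inv x = inv y \<otimes> inv x" by simp
  then show ?thesis
    using x y by (simp add: r_cancel_inverse mult_closed inverse_closed)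
qed

text \<open>Inversion reverses products and thus mirrors the left identity. The mirrored form is
  what makes the opposite loop Moufang.\<close>

lemma right_moufang:
  assumes "x \<in> carrier Q" "y \<in> carrier Q" "z \<in> carrier Q"
  shows "((z \<otimes> x) \<otimes> y) \<otimes> x = z \<otimes> (x \<otimes> (y \<otimes> x))"
proof -
  have "inv (((z \<otimes> x) \<otimes> y) \<otimes> x) = inv (z \<otimes> (x \<otimes> (y \<otimes> x)))"
    using moufang[of "inv x" "inv y" "inv z"] assms
    by (simp add: inverse_mult mult_closed inverse_closed)
  then have "inv (inv (((z \<otimes> x) \<otimes> y) \<otimes> x)) = inv (inv (z \<otimes> (x \<otimes> (y \<otimes> x))))"
    by simp
  then show ?thesis
    using assms by (simp add: inverse_inverse mult_closed)
qed

text \<open>With z = x t, flexibility and the right identity bring out the factor x y x, to which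
  the left identity applies.\<close>

lemma middle_moufang:
  assumes x: "x \<in> carrier Q" and y: "y \<in> carrier Q" and z: "z \<in> carrier Q"
  shows "(x \<otimes> y) \<otimes> (z \<otimes> x) = (x \<otimes> (y \<otimes> z)) \<otimes> x"
proof -
  define t where "t = inv x \<otimes> z"
  have t: "t \<in> carrier Q" "x \<otimes> t = z"
    using x z by (simp_all add: t_def mult_closed inverse_closed l_cancel_inverse)
  have "(x \<otimes> y) \<otimes> (z \<otimes> x) = (x \<otimes> y) \<otimes> (x \<otimes> (t \<otimes> x))"
    using flexible[of x t] x t by simp
  also have "\<dots> = (((x \<otimes> y) \<otimes> x) \<otimes> t) \<otimes> x"
    using right_moufang[of x t "x \<otimes> y"] x y t by (simp add: mult_closed)
  also have "\<dots> = (x \<otimes> (y \<otimes> z)) \<otimes> x"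
    using moufang[OF x y t(1)] t by simp
  finally show ?thesis .
qed

lemma moufang_loop_opposite: "moufang_loop (Q\<lparr>mult := \<lambda>x y. y \<otimes> x\<rparr>)"
  by unfold_locales
    (simp_all add: mult_closed one_closed left_one right_one left_division right_division right_moufang)

end

section \<open>Permutation groups and homomorphic images of p-subgroups\<close>

lemma BijGroup_simps:
  "carrier (BijGroup S) = Bij S"
  "\<one>\<^bsub>BijGroup S\<^esub> = (\<lambda>x\<in>S. x)"
  "\<lbrakk>f \<in> Bij S; g \<in> Bij S; x \<in> S\<rbrakk> \<Longrightarrow> (f \<otimes>\<^bsub>BijGroup S\<^esub> g) x = f (g x)"
  by (simp_all add: BijGroup_def compose_def)

lemma Bij_app_closed: "\<lbrakk>f \<in> Bij S; x \<in> S\<rbrakk> \<Longrightarrow> f x \<in> S"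
  using Bij_imp_funcset by blast

lemma Bij_eqI:
  assumes "f \<in> Bij S" "g \<in> Bij S" "\<And>x. x \<in> S \<Longrightarrow> f x = g x"
  shows "f = g"
  using Bij_imp_extensional[OF assms(1)] Bij_imp_extensional[OF assms(2)] assms(3)
  by (rule extensionalityI)

lemma finite_Bij:
  assumes "finite S"
  shows "finite (Bij S)"
proof (rule finite_subset)
  show "Bij S \<subseteq> S \<rightarrow>\<^sub>E S"
    using Bij_imp_funcset Bij_imp_extensional by (auto simp: PiE_def)
  show "finite (S \<rightarrow>\<^sub>E S)" using assms by (intro finite_PiE) simp_all
qed

text \<open>\<open>P\<close> acts transitively on its image by left multiplication through
  \<open>h\<close>, so orbit-stabilizer at the unit shows that the order of the image divides that
  of \<open>P\<close>.\<close>

lemma p_subgroup_hom_image: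
  assumes p: "prime p" and hom: "group_hom G H h" and P: "p_subgroup p G P"
  shows "p_subgroup p H (h ` P)"
proof -
  interpret h: group_hom G H h by (rule hom)
  note sP = p_subgroupD[OF P]
  note Pc = subgroup.mem_carrier[OF sP]
  have fP: "finite P" by (rule p_subgroup_finite[OF p P])
  interpret F: finite_action G P "h ` P" "\<lambda>g x. h g \<otimes>\<^bsub>H\<^esub> x"
  proof (intro finite_action.intro finite_action_axioms.intro h.G.group_axioms)
    show "h g \<otimes>\<^bsub>H\<^esub> x \<in> h ` P" if g: "g \<in> P" and x: "x \<in> h ` P" for g x
    proof -
      obtain y where y: "y \<in> P" "x = h y" using x by blast
      then have "h g \<otimes>\<^bsub>H\<^esub> x = h (g \<otimes>\<^bsub>G\<^esub> y)" using g Pc by simp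
      then show ?thesis using g y subgroup.m_closed[OF sP] by blast
    qed
    show "h (g \<otimes>\<^bsub>G\<^esub> g') \<otimes>\<^bsub>H\<^esub> x = h g \<otimes>\<^bsub>H\<^esub> (h g' \<otimes>\<^bsub>H\<^esub> x)"
      if "g \<in> P" "g' \<in> P" "x \<in> h ` P" for g g' x
      using that Pc h.H.m_assoc by auto
  qed (use fP sP Pc in auto)
  have one: "\<one>\<^bsub>H\<^esub> \<in> h ` P" using subgroup.one_closed[OF sP] h.hom_one by (metis imageI)
  have "{h g \<otimes>\<^bsub>H\<^esub> \<one>\<^bsub>H\<^esub> | g. g \<in> P} = h ` P"
    unfolding Setcompr_eq_image by (rule image_cong) (use Pc in simp_all)
  then have "card P = card (h ` P) * card {g \<in> P. h g \<otimes>\<^bsub>H\<^esub> \<one>\<^bsub>H\<^esub> = \<one>\<^bsub>H\<^esub>}"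
    using F.orbit_stabilizer[OF one] by simp
  then have dvd: "card (h ` P) dvd card P" by (rule dvdI)
  obtain n where n: "card P = p ^ n" using P by (auto simp: p_subgroup_def)
  have "subgroup (h ` P) H" using sP by (rule h.subgroup_img_is_subgroup)
  then show ?thesis using dvd unfolding n by (rule p_subgroupI_dvd[OF p])
qed

section \<open>The multiplication group\<close>

text \<open>Closure is given only for conjugation by members of \<open>D\<close>. Inside the
  normalizer of \<open>D\<close> it holds for all elements, and \<open>D\<close> lies there because
  its members are their own inverses.\<close>

lemma (in group) involution_set_normalizing:
  assumes fin: "finite (carrier G)" and p: "prime p" and D: "D \<subseteq> carrier G"
    and square: "\<And>d. d \<in> D \<Longrightarrow> d \<otimes> d = \<one>"
    and conj: "\<And>d e. \<lbrakk>d \<in> D; e \<in> D\<rbrakk> \<Longrightarrow> d \<otimes> e \<otimes> d \<in> D"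
    and pow: "\<And>d e. \<lbrakk>d \<in> D; e \<in> D\<rbrakk> \<Longrightarrow> \<exists>k. (d \<otimes> e) [^] (p ^ k) = \<one>"
  shows "subgroup (normalizing D) G" "involution_set (G\<lparr>carrier := normalizing D\<rparr>) D p"
proof -
  have fD: "finite D" using D fin by (rule finite_subset)
  show sN: "subgroup (normalizing D) G" by (rule subgroup_normalizing[OF D fD])
  have inv: "inv d = d" if "d \<in> D" for d
    using square that D by (intro inv_equality) auto
  show "involution_set (G\<lparr>carrier := normalizing D\<rparr>) D p"
  proof (intro involution_set.intro involution_set_axioms.intro)
    show "group (G\<lparr>carrier := normalizing D\<rparr>)" using sN by (rule subgroup_imp_group)
    show "finite (carrier (G\<lparr>carrier := normalizing D\<rparr>))"
      using finite_subset[OF subgroup.subset[OF sN] fin] by simp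
    show "D \<subseteq> carrier (G\<lparr>carrier := normalizing D\<rparr>)"
      using D conj inv by (auto simp: normalizing_def)
    show "g \<otimes>\<^bsub>G\<lparr>carrier := normalizing D\<rparr>\<^esub> d
        \<otimes>\<^bsub>G\<lparr>carrier := normalizing D\<rparr>\<^esub> inv\<^bsub>G\<lparr>carrier := normalizing D\<rparr>\<^esub> g \<in> D"
      if "g \<in> carrier (G\<lparr>carrier := normalizing D\<rparr>)" "d \<in> D" for g d
      using that m_inv_consistent[OF sN, of g] by (simp add: normalizing_def)
    show "\<exists>k. (d \<otimes>\<^bsub>G\<lparr>carrier := normalizing D\<rparr>\<^esub> e) [^]\<^bsub>G\<lparr>carrier := normalizing D\<rparr>\<^esub> (p ^ k)
        = \<one>\<^bsub>G\<lparr>carrier := normalizing D\<rparr>\<^esub>" if "d \<in> D" "e \<in> D" for d e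
      using pow[OF that] by (simp flip: nat_pow_consistent)
  qed (use p square in simp_all)
qed

context moufang_loop
begin

definition left_translation :: "'a \<Rightarrow> 'a \<Rightarrow> 'a" where
  "left_translation x = (\<lambda>z\<in>carrier Q. x \<otimes> z)"

definition left_mult_group :: "('a \<Rightarrow> 'a) set" where
  "left_mult_group = generate (BijGroup (carrier Q)) (left_translation ` carrier Q)"

text \<open>The elements \<open>(z, False)\<close> and \<open>(z, True)\<close> are the columns and the entries of the multiplication
  table, and \<open>row_swap x\<close> exchanges each column with the entry found there in row \<open>x\<close>.\<close>

definition row_swap :: "'a \<Rightarrow> 'a \<times> bool \<Rightarrow> 'a \<times> bool" where
  "row_swap x = (\<lambda>(z, b)\<in>carrier Q \<times> UNIV. (if b then inv x \<otimes> z else x \<otimes> z, \<not> b))"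

lemma row_swap_app:
  "z \<in> carrier Q \<Longrightarrow> row_swap x (z, b) = (if b then inv x \<otimes> z else x \<otimes> z, \<not> b)"
  by (simp add: row_swap_def)

lemma row_swap_Bij:
  assumes x: "x \<in> carrier Q"
  shows "row_swap x \<in> Bij (carrier Q \<times> UNIV)"
proof -
  have cl: "row_swap x y \<in> carrier Q \<times> UNIV" if "y \<in> carrier Q \<times> UNIV" for y
    using that x by (cases y) (simp add: row_swap_app mult_closed inverse_closed)
  have "row_swap x (row_swap x y) = y" if "y \<in> carrier Q \<times> UNIV" for y
    using that x
    by (cases y) (simp add: row_swap_app mult_closed inverse_closed inverse_l_cancel l_cancel_inverse)
  then have "bij_betw (row_swap x) (carrier Q \<times> UNIV) (carrier Q \<times> UNIV)"
    using image_subsetI[of "carrier Q \<times> UNIV" "row_swap x", OF cl]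
    by (intro bij_betw_byWitness[where f' = "row_swap x"]) simp_all
  then show ?thesis by (simp add: Bij_def row_swap_def)
qed

lemma left_translation_Bij:
  assumes x: "x \<in> carrier Q"
  shows "left_translation x \<in> Bij (carrier Q)"
proof -
  have "bij_betw (left_translation x) (carrier Q) (carrier Q)"
    by (rule bij_betw_byWitness[where f' = "left_translation (inv x)"])
      (use x in \<open>auto simp: left_translation_def mult_closed inverse_closed inverse_l_cancel l_cancel_inverse\<close>)
  then show ?thesis by (simp add: Bij_def left_translation_def)
qed

end

section \<open>Row swaps and the orders of their products\<close>

locale moufang_p_loop = moufang_loop Q for Q (structure) +
  fixes p n :: nat
  assumes finite_carrier: "finite (carrier Q)"
    and prime_p: "prime p"
    and card_carrier: "card (carrier Q) = p ^ n"
begin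

abbreviation "XG \<equiv> BijGroup (carrier Q \<times> (UNIV :: bool set))"

abbreviation "swaps \<equiv> row_swap ` carrier Q"

lemma group_XG: "group XG" by (rule group_BijGroup)

lemma swaps_subset: "swaps \<subseteq> carrier XG"
  using row_swap_Bij by (auto simp: BijGroup_simps)

text \<open>On entries this is L_x L_y^-1, on columns L_x^-1 L_y. Both layers are preserved, so
  products can be restricted to a single copy of Q.\<close>

lemma swap_prod_app:
  assumes "x \<in> carrier Q" "y \<in> carrier Q" "z \<in> carrier Q"
  shows "(row_swap x \<otimes>\<^bsub>XG\<^esub> row_swap y) (z, b)
    = (if b then x \<otimes> (inv y \<otimes> z) else inv x \<otimes> (y \<otimes> z), b)"
  using assms by (simp add: BijGroup_simps row_swap_Bij row_swap_app mult_closed inverse_closed)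

lemma swap_square:
  assumes "d \<in> swaps"
  shows "d \<otimes>\<^bsub>XG\<^esub> d = \<one>\<^bsub>XG\<^esub>"
proof -
  interpret X: group XG by (rule group_XG)
  obtain x where x: "x \<in> carrier Q" "d = row_swap x" using assms by blast
  show ?thesis
  proof (rule Bij_eqI)
    show "d \<otimes>\<^bsub>XG\<^esub> d \<in> Bij (carrier Q \<times> UNIV)" "\<one>\<^bsub>XG\<^esub> \<in> Bij (carrier Q \<times> UNIV)"
      using X.m_closed X.one_closed assms swaps_subset unfolding BijGroup_simps(1) by blast+
    show "(d \<otimes>\<^bsub>XG\<^esub> d) w = \<one>\<^bsub>XG\<^esub> w" if "w \<in> carrier Q \<times> UNIV" for w
      using that x by (cases w) (simp add: swap_prod_app BijGroup_simps inverse_l_cancel l_cancel_inverse)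
  qed
qed

text \<open>On columns this is the Moufang identity for x and y^-1, on entries for x^-1 and y. The
  two fit together because (x^-1 y) x^-1 is the inverse of (x y^-1) x, by flexibility.\<close>

lemma swap_conj:
  assumes x: "x \<in> carrier Q" and y: "y \<in> carrier Q"
  shows "row_swap x \<otimes>\<^bsub>XG\<^esub> row_swap y \<otimes>\<^bsub>XG\<^esub> row_swap x = row_swap ((x \<otimes> inv y) \<otimes> x)"
proof (rule Bij_eqI)
  interpret X: group XG by (rule group_XG)
  have cl: "row_swap x \<in> carrier XG" "row_swap y \<in> carrier XG"
    using x y by (simp_all add: BijGroup_simps row_swap_Bij)
  have pr: "row_swap x \<otimes>\<^bsub>XG\<^esub> row_swap y \<in> Bij (carrier Q \<times> UNIV)"
    using X.m_closed[OF cl] by (simp add: BijGroup_simps)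
  show "row_swap x \<otimes>\<^bsub>XG\<^esub> row_swap y \<otimes>\<^bsub>XG\<^esub> row_swap x \<in> Bij (carrier Q \<times> UNIV)"
    using X.m_closed[OF X.m_closed[OF cl] cl(1)] by (simp add: BijGroup_simps)
  show "row_swap ((x \<otimes> inv y) \<otimes> x) \<in> Bij (carrier Q \<times> UNIV)"
    using x y by (simp add: row_swap_Bij mult_closed inverse_closed)
  fix w assume w: "w \<in> carrier Q \<times> (UNIV :: bool set)"
  obtain z b where zb: "w = (z, b)" "z \<in> carrier Q" using w by blast
  have inv_eq: "inv ((x \<otimes> inv y) \<otimes> x) = (inv x \<otimes> y) \<otimes> inv x"
    using x y flexible[of "inv x" y] by (simp add: inverse_mult mult_closed inverse_closed inverse_inverse)
  have "(row_swap x \<otimes>\<^bsub>XG\<^esub> row_swap y \<otimes>\<^bsub>XG\<^esub> row_swap x) w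
    = (row_swap x \<otimes>\<^bsub>XG\<^esub> row_swap y) (row_swap x w)"
    using w x pr by (simp only: BijGroup_simps row_swap_Bij)
  also have "\<dots> = row_swap ((x \<otimes> inv y) \<otimes> x) w"
    using zb x y moufang[of x "inv y" z] moufang[of "inv x" y z] unfolding inv_eq[symmetric]
    by (simp add: row_swap_app swap_prod_app mult_closed inverse_closed inv_eq)
  finally show "(row_swap x \<otimes>\<^bsub>XG\<^esub> row_swap y \<otimes>\<^bsub>XG\<^esub> row_swap x) w
    = row_swap ((x \<otimes> inv y) \<otimes> x) w" .
qed

lemma swaps_conj: "\<lbrakk>d \<in> swaps; e \<in> swaps\<rbrakk> \<Longrightarrow> d \<otimes>\<^bsub>XG\<^esub> e \<otimes>\<^bsub>XG\<^esub> d \<in> swaps"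
  using swap_conj by (auto simp: mult_closed inverse_closed)

text \<open>The multiplication table is a Latin square, so two different rows disagree in every
  column.\<close>

lemma swap_eq_of_common_value:
  assumes "x \<in> carrier Q" "y \<in> carrier Q" "w \<in> carrier Q \<times> UNIV" "row_swap x w = row_swap y w"
  shows "x = y"
proof -
  obtain z b where w: "w = (z, b)" "z \<in> carrier Q" using assms(3) by blast
  then have "x = y \<or> inv x = inv y"
    using assms by (cases b) (simp_all add: row_swap_app loop_r_cancel inverse_closed)
  then show ?thesis using assms inverse_inverse by metis
qed

text \<open>Multiplying \<open>(d e)\<^sup>k\<close> by \<open>e\<close> gives a conjugate of \<open>d\<close> or of \<open>e\<close>.\<close>

lemma pow_swaps_mult:
  assumes d: "d \<in> swaps" and e: "e \<in> swaps"
  shows "(d \<otimes>\<^bsub>XG\<^esub> e) [^]\<^bsub>XG\<^esub> (k::nat) \<otimes>\<^bsub>XG\<^esub> e \<in> swaps"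
proof -
  interpret X: group XG by (rule group_XG)
  have dc: "d \<in> carrier XG" and ec: "e \<in> carrier XG" using d e swaps_subset by blast+
  note sq = swap_square[OF d] swap_square[OF e]
  have e_cancel: "e \<otimes>\<^bsub>XG\<^esub> (e \<otimes>\<^bsub>XG\<^esub> x) = x" if "x \<in> carrier XG" for x
    using that ec sq by (simp flip: X.m_assoc)
  let ?u = "d \<otimes>\<^bsub>XG\<^esub> e"
  show ?thesis
  proof (induction k rule: nat_induct2)
    case 0
    then show ?case using e ec by simp
  next
    case 1
    then show ?case using d dc ec sq by (simp add: X.m_assoc)
  next
    case (step k)
    let ?v = "?u [^]\<^bsub>XG\<^esub> k"
    have vc: "?v \<in> carrier XG" using dc ec by simp
    have "e \<otimes>\<^bsub>XG\<^esub> (?v \<otimes>\<^bsub>XG\<^esub> e) \<otimes>\<^bsub>XG\<^esub> e \<in> swaps" by (rule swaps_conj[OF e step])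
    then have "d \<otimes>\<^bsub>XG\<^esub> (e \<otimes>\<^bsub>XG\<^esub> (?v \<otimes>\<^bsub>XG\<^esub> e) \<otimes>\<^bsub>XG\<^esub> e) \<otimes>\<^bsub>XG\<^esub> d \<in> swaps" by (rule swaps_conj[OF d])
    \<comment> \<open>Conjugating u^k e by e and then by d gives d e u^k d, and this is u^(k+2) e
      because u e = d.\<close>
    moreover have "?u [^]\<^bsub>XG\<^esub> (k + 2) = ?u \<otimes>\<^bsub>XG\<^esub> ?v \<otimes>\<^bsub>XG\<^esub> ?u"
      using dc ec by (simp add: numeral_2_eq_2 X.nat_pow_Suc2 X.m_assoc flip: X.nat_pow_Suc2)
    ultimately show ?case
      using dc ec vc sq by (simp add: X.m_assoc)
  qed
qed

lemma pow_swaps_fixed_point: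
  assumes d: "d \<in> swaps" and e: "e \<in> swaps" and w: "w \<in> carrier Q \<times> UNIV"
    and fixed: "((d \<otimes>\<^bsub>XG\<^esub> e) [^]\<^bsub>XG\<^esub> (k::nat)) w = w"
  shows "(d \<otimes>\<^bsub>XG\<^esub> e) [^]\<^bsub>XG\<^esub> k = \<one>\<^bsub>XG\<^esub>"
proof -
  interpret X: group XG by (rule group_XG)
  have dc: "d \<in> carrier XG" and ec: "e \<in> carrier XG" using d e swaps_subset by blast+
  let ?v = "(d \<otimes>\<^bsub>XG\<^esub> e) [^]\<^bsub>XG\<^esub> k"
  have vc: "?v \<in> carrier XG" using dc ec by simp
  have Bij: "?v \<in> Bij (carrier Q \<times> UNIV)" "e \<in> Bij (carrier Q \<times> UNIV)"
    using vc ec by (simp_all only: BijGroup_simps)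
  obtain x where x: "x \<in> carrier Q" "?v \<otimes>\<^bsub>XG\<^esub> e = row_swap x"
    using pow_swaps_mult[OF d e, of k] by blast
  obtain y where y: "y \<in> carrier Q" "e = row_swap y" using e by blast
  have ew: "e w \<in> carrier Q \<times> UNIV" using Bij(2) w by (rule Bij_app_closed)
  have "e (e w) = (e \<otimes>\<^bsub>XG\<^esub> e) w" using Bij w by (simp only: BijGroup_simps)
  also have "\<dots> = w" using swap_square[OF e] w by (simp add: BijGroup_simps)
  finally have ee: "e (e w) = w" .
  \<comment> \<open>The swaps \<open>?v e\<close> and \<open>e\<close> are compared at the point
    \<open>e w\<close>: since \<open>?v\<close> fixes \<open>w\<close>, both send it to
    \<open>w\<close>.\<close>
  have "(?v \<otimes>\<^bsub>XG\<^esub> e) (e w) = ?v (e (e w))" using Bij ew by (simp only: BijGroup_simps)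
  then have "row_swap x (e w) = row_swap y (e w)" using fixed ee x y by simp
  then have "x = y" by (rule swap_eq_of_common_value[OF x(1) y(1) ew])
  then have "?v \<otimes>\<^bsub>XG\<^esub> e = e" using x y by simp
  then show ?thesis using vc ec X.r_cancel_one' by metis
qed

text \<open>A power of d e with a fixed point is trivial, so every orbit of the cyclic group on the
  entries is as long as the group itself, whose order must divide p^n.\<close>

lemma pow_swaps:
  assumes d: "d \<in> swaps" and e: "e \<in> swaps"
  shows "(d \<otimes>\<^bsub>XG\<^esub> e) [^]\<^bsub>XG\<^esub> (p ^ n) = \<one>\<^bsub>XG\<^esub>"
proof -
  interpret X: group XG by (rule group_XG)
  have dc: "d \<in> carrier XG" and ec: "e \<in> carrier XG" using d e swaps_subset by blast+
  obtain x y where xy: "x \<in> carrier Q" "d = row_swap x" "y \<in> carrier Q" "e = row_swap y"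
    using d e by blast
  let ?u = "d \<otimes>\<^bsub>XG\<^esub> e"
  have uc: "?u \<in> carrier XG" using dc ec by simp
  have fin: "finite (carrier XG)"
    using finite_carrier by (simp add: BijGroup_simps finite_Bij)
  define P where "P = generate XG {?u}"
  have sP: "subgroup P XG" unfolding P_def using uc by (intro X.generate_is_subgroup) simp
  have Pc: "g \<in> Bij (carrier Q \<times> UNIV)" if "g \<in> P" for g
    using subgroup.mem_carrier[OF sP that] by (simp only: BijGroup_simps)
  have P_pow: "\<exists>k::nat. g = ?u [^]\<^bsub>XG\<^esub> k" if "g \<in> P" for g
    using that X.generate_pow_on_finite_carrier[OF fin uc] by (auto simp: P_def)
  \<comment> \<open>One layer has exactly p^n points; both layers together would leave a spurious
    factor 2.\<close>
  let ?E = "carrier Q \<times> {True}"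
  have pow_E: "(?u [^]\<^bsub>XG\<^esub> (k::nat)) w \<in> ?E" if "w \<in> ?E" for k w
    using that
  proof (induction k arbitrary: w)
    case 0
    then show ?case by (auto simp: BijGroup_simps)
  next
    case (Suc k)
    have "?u [^]\<^bsub>XG\<^esub> k \<in> Bij (carrier Q \<times> UNIV)" "?u \<in> Bij (carrier Q \<times> UNIV)"
      using X.nat_pow_closed[OF uc] uc by (simp_all only: BijGroup_simps)
    moreover have "w \<in> carrier Q \<times> UNIV" using Suc.prems by blast
    ultimately have "(?u [^]\<^bsub>XG\<^esub> Suc k) w = (?u [^]\<^bsub>XG\<^esub> k) (?u w)"
      by (simp only: X.nat_pow_Suc BijGroup_simps)
    moreover have "?u w \<in> ?E"
      using Suc.prems xy by (auto simp: swap_prod_app mult_closed inverse_closed)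
    ultimately show ?case using Suc.IH by simp
  qed
  interpret F: finite_action XG P ?E "\<lambda>g w. g w"
  proof (intro finite_action.intro finite_action_axioms.intro X.group_axioms)
    show "finite P" using finite_subset[OF subgroup.subset[OF sP] fin] .
    show "finite ?E" using finite_carrier by simp
    show "g w \<in> ?E" if "g \<in> P" "w \<in> ?E" for g w
      using P_pow[OF that(1)] pow_E[OF that(2)] by blast
    show "\<one>\<^bsub>XG\<^esub> w = w" if "w \<in> ?E" for w
      using that by (auto simp: BijGroup_simps)
    show "(g \<otimes>\<^bsub>XG\<^esub> h) w = g (h w)" if "g \<in> P" "h \<in> P" "w \<in> ?E" for g h w
      using that Pc by (intro BijGroup_simps) auto
  qed (rule sP)
  have "card P dvd card ?E"
  proof (rule F.dvd_card_of_dvd_orbits)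
    fix w assume w: "w \<in> ?E"
    have "{g \<in> P. g w = w} = {\<one>\<^bsub>XG\<^esub>}"
    proof
      show "{g \<in> P. g w = w} \<subseteq> {\<one>\<^bsub>XG\<^esub>}"
      proof
        fix g assume g: "g \<in> {g \<in> P. g w = w}"
        then obtain k :: nat where "g = ?u [^]\<^bsub>XG\<^esub> k" using P_pow by blast
        then show "g \<in> {\<one>\<^bsub>XG\<^esub>}"
          using pow_swaps_fixed_point[OF d e, of w k] g w by auto
      qed
      show "{\<one>\<^bsub>XG\<^esub>} \<subseteq> {g \<in> P. g w = w}"
        using subgroup.one_closed[OF sP] F.act_one[OF w] by simp
    qed
    then show "card P dvd card {g w | g. g \<in> P}"
      using F.orbit_stabilizer[OF w] by simp
  qed
  then have "X.ord ?u dvd p ^ n"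
    using X.generate_pow_card[OF uc] card_carrier by (simp add: P_def card_cartesian_product)
  then show ?thesis using X.pow_eq_id[OF uc] by simp
qed

text \<open>The conclusion speaks of products because for odd p the swaps have order prime to p. The
  normalizer of the swaps serves as the ambient group.\<close>

lemma p_subgroup_swap_products:
  obtains P where "p_subgroup p XG P" "\<And>d e. \<lbrakk>d \<in> swaps; e \<in> swaps\<rbrakk> \<Longrightarrow> d \<otimes>\<^bsub>XG\<^esub> e \<in> P"
proof -
  interpret X: group XG by (rule group_XG)
  let ?N = "X.normalizing swaps"
  let ?G = "XG\<lparr>carrier := ?N\<rparr>"
  have fin: "finite (carrier XG)"
    using finite_carrier by (simp add: BijGroup_simps finite_Bij)
  have pow: "\<exists>k. (d \<otimes>\<^bsub>XG\<^esub> e) [^]\<^bsub>XG\<^esub> (p ^ k) = \<one>\<^bsub>XG\<^esub>" if "d \<in> swaps" "e \<in> swaps" for d e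
    using pow_swaps[OF that] by blast
  note inv = X.involution_set_normalizing[OF fin prime_p swaps_subset swap_square swaps_conj pow]
  interpret I: involution_set ?G swaps p by (rule inv(2))
  have "\<exists>P. p_subgroup p ?G P \<and> (\<forall>d\<in>swaps. \<forall>e\<in>swaps. d \<otimes>\<^bsub>XG\<^esub> e \<in> P)"
  proof (cases "odd p")
    case True
    have "inj_on row_swap (carrier Q)"
      using swap_eq_of_common_value[of _ _ "(\<one>, False)"] one_closed by (intro inj_onI) auto
    then have "card swaps = p ^ n" using card_carrier by (simp add: card_image)
    then obtain P where "p_subgroup p ?G P"
      "\<And>d e. \<lbrakk>d \<in> swaps; e \<in> swaps\<rbrakk> \<Longrightarrow> d \<otimes>\<^bsub>?G\<^esub> e \<in> P"
      using I.p_subgroup_containing_products_odd[OF True] by blast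
    then show ?thesis by auto
  next
    case False
    then have "p = 2" using prime_p prime_odd_nat by (metis le_neq_implies_less prime_ge_2_nat)
    then obtain P where P: "p_subgroup p ?G P" "swaps \<subseteq> P" by (rule I.two_subgroup_containing)
    have "d \<otimes>\<^bsub>XG\<^esub> e \<in> P" if "d \<in> swaps" "e \<in> swaps" for d e
      using subgroup.m_closed[OF p_subgroupD[OF P(1)], of d e] that P(2) by auto
    then show ?thesis using P by blast
  qed
  then obtain P where P: "p_subgroup p ?G P" "\<forall>d\<in>swaps. \<forall>e\<in>swaps. d \<otimes>\<^bsub>XG\<^esub> e \<in> P" by blast
  then have "p_subgroup p XG P"
    using X.incl_subgroup[OF inv(1)] by (auto simp: p_subgroup_def)
  then show ?thesis using P that by blast
qed

end

context moufang_p_loop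
begin

abbreviation "QG \<equiv> BijGroup (carrier Q)"

lemma group_QG: "group QG" by (rule group_BijGroup)

text \<open>\<open>P\<close> may contain elements exchanging columns and entries, such as the swaps
  themselves for p = 2. The subgroup \<open>H\<close> generated by the products preserves entries,
  and restriction to them is a homomorphism whose image contains all left translations.\<close>

lemma p_subgroup_left_mult_group: "p_subgroup p QG left_mult_group"
proof -
  interpret X: group XG by (rule group_XG)
  interpret B: group QG by (rule group_QG)
  obtain P where P: "p_subgroup p XG P" "\<And>d e. \<lbrakk>d \<in> swaps; e \<in> swaps\<rbrakk> \<Longrightarrow> d \<otimes>\<^bsub>XG\<^esub> e \<in> P"
    using p_subgroup_swap_products by blast
  define S where "S = {d \<otimes>\<^bsub>XG\<^esub> e | d e. d \<in> swaps \<and> e \<in> swaps}"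
  define H where "H = generate XG S"
  have SP: "S \<subseteq> P" using P(2) by (auto simp: S_def)
  then have Sc: "S \<subseteq> carrier XG" using subgroup.subset[OF p_subgroupD[OF P(1)]] by blast
  have sH: "subgroup H XG" unfolding H_def by (rule X.generate_is_subgroup[OF Sc])
  have H_Bij: "h \<in> Bij (carrier Q \<times> UNIV)" if "h \<in> H" for h
    using subgroup.mem_carrier[OF sH that] by (simp only: BijGroup_simps)
  have "H \<subseteq> P" unfolding H_def by (rule X.generate_subgroup_incl[OF SP p_subgroupD[OF P(1)]])
  then have pXH: "p_subgroup p XG H" by (rule X.p_subgroup_mono[OF prime_p P(1) sH])
  interpret H: group "XG\<lparr>carrier := H\<rparr>" using sH by (rule X.subgroup_imp_group)
  have pH: "p_subgroup p (XG\<lparr>carrier := H\<rparr>) H"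
    using pXH H.subgroup_self by (simp add: p_subgroup_def)
  have S_layer: "\<exists>z'\<in>carrier Q. s (z, True) = (z', True)" if "s \<in> S" "z \<in> carrier Q" for s z
    using that by (auto simp: S_def swap_prod_app mult_closed inverse_closed)
  have layer: "\<exists>z'\<in>carrier Q. h (z, True) = (z', True)" if "h \<in> H" "z \<in> carrier Q" for h z
    using that unfolding H_def
  proof (induction arbitrary: z)
    case one
    then show ?case by (simp add: BijGroup_simps)
  next
    case (incl h)
    then show ?case by (rule S_layer)
  next
    case (inv h)
    then obtain d e where de: "h = d \<otimes>\<^bsub>XG\<^esub> e" "d \<in> swaps" "e \<in> swaps" by (auto simp: S_def)
    then have dc: "d \<in> carrier XG" and ec: "e \<in> carrier XG" using swaps_subset by blast+
    then have "inv\<^bsub>XG\<^esub> d = d" "inv\<^bsub>XG\<^esub> e = e"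
      using swap_square de by (simp_all add: X.inv_equality)
    then have "inv\<^bsub>XG\<^esub> h = e \<otimes>\<^bsub>XG\<^esub> d" using X.inv_mult_group[OF dc ec] de(1) by simp
    then have "inv\<^bsub>XG\<^esub> h \<in> S" using de by (auto simp: S_def)
    then show ?case using inv.prems by (rule S_layer)
  next
    case (eng h1 h2)
    obtain z' where z': "z' \<in> carrier Q" "h2 (z, True) = (z', True)" using eng by blast
    moreover obtain z'' where "z'' \<in> carrier Q" "h1 (z', True) = (z'', True)" using eng z'(1) by blast
    moreover have "(h1 \<otimes>\<^bsub>XG\<^esub> h2) (z, True) = h1 (h2 (z, True))"
      using eng H_Bij by (intro BijGroup_simps) (simp_all add: H_def)
    ultimately show ?case by simp
  qed
  define \<phi> where "\<phi> h = (\<lambda>z\<in>carrier Q. fst (h (z, True)))" for h :: "'a \<times> bool \<Rightarrow> 'a \<times> bool"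
  have \<phi>: "h (z, True) = (\<phi> h z, True)" "\<phi> h z \<in> carrier Q" if "h \<in> H" "z \<in> carrier Q" for h z
    using layer[OF that] that(2) by (auto simp: \<phi>_def)
  have \<phi>_mult: "\<phi> (g \<otimes>\<^bsub>XG\<^esub> h) z = \<phi> g (\<phi> h z)" if "g \<in> H" "h \<in> H" "z \<in> carrier Q" for g h z
  proof -
    have "(g \<otimes>\<^bsub>XG\<^esub> h) (z, True) = g (h (z, True))"
      using that H_Bij by (intro BijGroup_simps) simp_all
    also have "\<dots> = (\<phi> g (\<phi> h z), True)" using \<phi> that by simp
    finally show ?thesis using that(3) by (simp add: \<phi>_def)
  qed
  have \<phi>_one: "\<phi> \<one>\<^bsub>XG\<^esub> z = z" if "z \<in> carrier Q" for z
    using that by (simp add: \<phi>_def BijGroup_simps)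
  have \<phi>_Bij: "\<phi> h \<in> Bij (carrier Q)" if h: "h \<in> H" for h
  proof -
    have inv: "inv\<^bsub>XG\<^esub> h \<in> H" using subgroup.m_inv_closed[OF sH h] .
    have hc: "h \<in> carrier XG" by (rule subgroup.mem_carrier[OF sH h])
    have "bij_betw (\<phi> h) (carrier Q) (carrier Q)"
    proof (rule bij_betw_byWitness[where f' = "\<phi> (inv\<^bsub>XG\<^esub> h)"])
      show "\<forall>z\<in>carrier Q. \<phi> (inv\<^bsub>XG\<^esub> h) (\<phi> h z) = z"
        using \<phi>_mult[OF inv h] \<phi>_one X.l_inv[OF hc] by simp
      show "\<forall>z\<in>carrier Q. \<phi> h (\<phi> (inv\<^bsub>XG\<^esub> h) z) = z"
        using \<phi>_mult[OF h inv] \<phi>_one X.r_inv[OF hc] by simp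
    qed (use \<phi>(2) h inv in auto)
    then show ?thesis by (simp add: Bij_def \<phi>_def)
  qed
  have "\<phi> \<in> hom (XG\<lparr>carrier := H\<rparr>) QG"
  proof (rule homI)
    fix g h assume gh: "g \<in> carrier (XG\<lparr>carrier := H\<rparr>)" "h \<in> carrier (XG\<lparr>carrier := H\<rparr>)"
    have "\<phi> (g \<otimes>\<^bsub>XG\<^esub> h) = \<phi> g \<otimes>\<^bsub>QG\<^esub> \<phi> h"
    proof (rule Bij_eqI)
      show "\<phi> (g \<otimes>\<^bsub>XG\<^esub> h) \<in> Bij (carrier Q)"
        using gh subgroup.m_closed[OF sH] by (intro \<phi>_Bij) simp
      show "\<phi> g \<otimes>\<^bsub>QG\<^esub> \<phi> h \<in> Bij (carrier Q)"
        using gh \<phi>_Bij B.m_closed[of "\<phi> g" "\<phi> h"] by (simp add: BijGroup_simps(1))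
      show "\<phi> (g \<otimes>\<^bsub>XG\<^esub> h) z = (\<phi> g \<otimes>\<^bsub>QG\<^esub> \<phi> h) z" if "z \<in> carrier Q" for z
        using gh that \<phi>_mult \<phi>_Bij by (simp add: BijGroup_simps)
    qed
    then show "\<phi> (g \<otimes>\<^bsub>XG\<lparr>carrier := H\<rparr>\<^esub> h) = \<phi> g \<otimes>\<^bsub>QG\<^esub> \<phi> h" by simp
  qed (use \<phi>_Bij in \<open>simp add: BijGroup_simps\<close>)
  then have "group_hom (XG\<lparr>carrier := H\<rparr>) QG \<phi>"
    using H.is_group B.is_group by (simp add: group_hom_def group_hom_axioms_def)
  then have image: "p_subgroup p QG (\<phi> ` H)"
    by (rule p_subgroup_hom_image[OF prime_p _ pH])
  have "left_translation ` carrier Q \<subseteq> \<phi> ` H"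
  proof
    fix l assume "l \<in> left_translation ` carrier Q"
    then obtain x where x: "x \<in> carrier Q" "l = left_translation x" by blast
    \<comment> \<open>On entries, t_x t_1 is left multiplication by x, as the inverse of 1 is
      1.\<close>
    let ?h = "row_swap x \<otimes>\<^bsub>XG\<^esub> row_swap \<one>"
    have "?h \<in> S" using x one_closed by (auto simp: S_def)
    then have h: "?h \<in> H" unfolding H_def by (rule generate.incl)
    have inv_one: "inv \<one> = \<one>" using l_inverse[OF one_closed] right_one[OF inverse_closed[OF one_closed]] by simp
    have "\<phi> ?h z = left_translation x z" if "z \<in> carrier Q" for z
      using that x one_closed
      by (simp add: \<phi>_def swap_prod_app left_translation_def inv_one left_one)
    then have "\<phi> ?h = l" unfolding x(2)
      by (intro Bij_eqI[OF \<phi>_Bij[OF h] left_translation_Bij[OF x(1)]])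
    then show "l \<in> \<phi> ` H" using h by blast
  qed
  then have incl: "left_mult_group \<subseteq> \<phi> ` H"
    unfolding left_mult_group_def by (rule B.generate_subgroup_incl[OF _ p_subgroupD[OF image]])
  have "left_translation ` carrier Q \<subseteq> carrier QG"
    using left_translation_Bij by (auto simp: BijGroup_simps)
  then have "subgroup left_mult_group QG"
    unfolding left_mult_group_def by (rule B.generate_is_subgroup)
  then show ?thesis using incl by (rule B.p_subgroup_mono[OF prime_p image])
qed

end

section \<open>Right translations and their action on left translations\<close>

context moufang_loop
begin

definition right_translation :: "'a \<Rightarrow> 'a \<Rightarrow> 'a" where
  "right_translation x = (\<lambda>z\<in>carrier Q. z \<otimes> x)"

lemma right_translation_Bij:
  assumes x: "x \<in> carrier Q"
  shows "right_translation x \<in> Bij (carrier Q)"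
proof -
  have "bij_betw (right_translation x) (carrier Q) (carrier Q)"
    by (rule bij_betw_byWitness[where f' = "right_translation (inv x)"])
      (use x in \<open>auto simp: right_translation_def mult_closed inverse_closed r_cancel_inverse inverse_r_cancel\<close>)
  then show ?thesis by (simp add: Bij_def right_translation_def)
qed

definition right_mult_group :: "('a \<Rightarrow> 'a) set" where
  "right_mult_group = generate (BijGroup (carrier Q)) (right_translation ` carrier Q)"

lemma inv_right_translation:
  assumes x: "x \<in> carrier Q"
  shows "inv\<^bsub>BijGroup (carrier Q)\<^esub> right_translation x = right_translation (inv x)"
proof -
  interpret B: group "BijGroup (carrier Q)" by (rule group_BijGroup)
  have cl: "right_translation x \<in> carrier (BijGroup (carrier Q))"
    "right_translation (inv x) \<in> carrier (BijGroup (carrier Q))"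
    using x by (simp_all add: BijGroup_simps right_translation_Bij inverse_closed)
  have "right_translation (inv x) \<otimes>\<^bsub>BijGroup (carrier Q)\<^esub> right_translation x
      = \<one>\<^bsub>BijGroup (carrier Q)\<^esub>"
  proof (rule Bij_eqI)
    show "right_translation (inv x) \<otimes>\<^bsub>BijGroup (carrier Q)\<^esub> right_translation x \<in> Bij (carrier Q)"
      using B.m_closed[OF cl(2,1)] by (simp add: BijGroup_simps)
    show "\<one>\<^bsub>BijGroup (carrier Q)\<^esub> \<in> Bij (carrier Q)"
      using B.one_closed by (simp add: BijGroup_simps)
  qed (use x in \<open>simp add: BijGroup_simps right_translation_Bij inverse_closed,
        simp add: right_translation_def mult_closed r_cancel_inverse\<close>)
  then show ?thesis using B.inv_equality[OF _ cl] by simp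
qed

text \<open>Evaluated at z = w x, this is the middle Moufang identity in the form (x y)(w x) = x ((y
  w) x). It makes right translations normalize the left multiplication group.\<close>

lemma left_mult_group_conj_right_translation:
  assumes x: "x \<in> carrier Q" and y: "y \<in> carrier Q"
  shows "right_translation x \<otimes>\<^bsub>BijGroup (carrier Q)\<^esub> left_translation y
      \<otimes>\<^bsub>BijGroup (carrier Q)\<^esub> inv\<^bsub>BijGroup (carrier Q)\<^esub> right_translation x
    = left_translation (inv x) \<otimes>\<^bsub>BijGroup (carrier Q)\<^esub> left_translation (x \<otimes> y)"
    (is "?l = ?r")
proof (rule Bij_eqI)
  interpret B: group "BijGroup (carrier Q)" by (rule group_BijGroup)
  have Bij: "right_translation x \<in> Bij (carrier Q)" "right_translation (inv x) \<in> Bij (carrier Q)"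
    "left_translation y \<in> Bij (carrier Q)" "left_translation (inv x) \<in> Bij (carrier Q)"
    "left_translation (x \<otimes> y) \<in> Bij (carrier Q)"
    using x y by (simp_all add: right_translation_Bij left_translation_Bij inverse_closed mult_closed)
  note cl = Bij[folded BijGroup_simps(1)]
  have l: "?l = right_translation x \<otimes>\<^bsub>BijGroup (carrier Q)\<^esub> left_translation y
      \<otimes>\<^bsub>BijGroup (carrier Q)\<^esub> right_translation (inv x)"
    using inv_right_translation[OF x] by simp
  have prod: "right_translation x \<otimes>\<^bsub>BijGroup (carrier Q)\<^esub> left_translation y \<in> Bij (carrier Q)"
    using B.m_closed[OF cl(1,3)] by (simp add: BijGroup_simps)
  show "?l \<in> Bij (carrier Q)" "?r \<in> Bij (carrier Q)"
    unfolding l using B.m_closed[OF B.m_closed[OF cl(1,3)] cl(2)] B.m_closed[OF cl(4,5)]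
    by (simp_all add: BijGroup_simps)
  fix z assume z: "z \<in> carrier Q"
  let ?w = "z \<otimes> inv x"
  have w: "?w \<in> carrier Q" "?w \<otimes> x = z"
    using x z by (simp_all add: mult_closed inverse_closed inverse_r_cancel)
  have "x \<otimes> ((y \<otimes> ?w) \<otimes> x) = (x \<otimes> y) \<otimes> z"
    using middle_moufang[OF x y w(1)] flexible[of x "y \<otimes> ?w"] x y w by (simp add: mult_closed)
  then have "(y \<otimes> ?w) \<otimes> x = inv x \<otimes> ((x \<otimes> y) \<otimes> z)"
    using inverse_l_cancel[OF x, of "(y \<otimes> ?w) \<otimes> x"] x y w by (simp add: mult_closed)
  moreover have "?l z = (y \<otimes> ?w) \<otimes> x"
    unfolding l using x y z w(1) Bij prod
    by (simp add: BijGroup_simps Bij_app_closed) (simp add: right_translation_def left_translation_def mult_closed)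
  moreover have "?r z = inv x \<otimes> ((x \<otimes> y) \<otimes> z)"
    using x y z Bij by (simp add: BijGroup_simps) (simp add: left_translation_def mult_closed)
  ultimately show "?l z = ?r z" by simp
qed

end

section \<open>The multiplication group and a nontrivial center\<close>

context moufang_p_loop
begin

text \<open>The left translations of the opposite loop are the right translations of
  \<open>Q\<close>, as permutations of the same set.\<close>

lemma p_subgroup_right_mult_group: "p_subgroup p QG right_mult_group"
proof -
  let ?Q = "Q\<lparr>mult := \<lambda>x y. y \<otimes> x\<rparr>"
  interpret O: moufang_p_loop ?Q p n
    using moufang_loop_opposite finite_carrier prime_p card_carrier
    by (intro moufang_p_loop.intro moufang_p_loop_axioms.intro) simp_all
  have "O.left_translation = right_translation"
    by (simp add: O.left_translation_def right_translation_def fun_eq_iff)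
  then have "O.left_mult_group = right_mult_group"
    by (simp add: O.left_mult_group_def right_mult_group_def)
  then show ?thesis using O.p_subgroup_left_mult_group by simp
qed

lemma mult_group:
  obtains M where "p_subgroup p QG M"
    "left_translation ` carrier Q \<subseteq> M" "right_translation ` carrier Q \<subseteq> M"
proof -
  interpret B: group QG by (rule group_QG)
  note sL = p_subgroupD[OF p_subgroup_left_mult_group]
  note sR = p_subgroupD[OF p_subgroup_right_mult_group]
  have norm: "g \<otimes>\<^bsub>QG\<^esub> h \<otimes>\<^bsub>QG\<^esub> inv\<^bsub>QG\<^esub> g \<in> left_mult_group"
    if "h \<in> left_mult_group" "g \<in> right_mult_group" for g h
    unfolding left_mult_group_def
  proof (rule B.generate_conj)
    show "right_translation ` carrier Q \<subseteq> carrier QG" "left_translation ` carrier Q \<subseteq> carrier QG"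
      using right_translation_Bij left_translation_Bij by (auto simp: BijGroup_simps)
    show "inv\<^bsub>QG\<^esub> g \<in> right_translation ` carrier Q" if "g \<in> right_translation ` carrier Q" for g
      using that by (auto simp: inv_right_translation inverse_closed)
    show "g \<otimes>\<^bsub>QG\<^esub> h \<otimes>\<^bsub>QG\<^esub> inv\<^bsub>QG\<^esub> g \<in> generate QG (left_translation ` carrier Q)"
      if gh: "g \<in> right_translation ` carrier Q" "h \<in> left_translation ` carrier Q" for g h
    proof -
      obtain x where x: "x \<in> carrier Q" "g = right_translation x" using gh(1) by blast
      obtain y where y: "y \<in> carrier Q" "h = left_translation y" using gh(2) by blast
      show ?thesis
        unfolding x(2) y(2) left_mult_group_conj_right_translation[OF x(1) y(1)]
        by (rule generate.eng[OF generate.incl generate.incl])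
          (use x y in \<open>simp_all add: inverse_closed mult_closed\<close>)
    qed
  qed (use that in \<open>simp_all add: left_mult_group_def right_mult_group_def\<close>)
  note set_mult = B.subgroup_set_mult[OF sL sR norm]
  show ?thesis
  proof (rule that[of "left_mult_group <#>\<^bsub>QG\<^esub> right_mult_group"])
    show "p_subgroup p QG (left_mult_group <#>\<^bsub>QG\<^esub> right_mult_group)"
      by (rule B.p_subgroup_set_mult[OF prime_p p_subgroup_left_mult_group
            p_subgroup_right_mult_group norm])
    have "left_translation ` carrier Q \<subseteq> left_mult_group"
      unfolding left_mult_group_def by (auto intro: generate.incl)
    then show "left_translation ` carrier Q \<subseteq> left_mult_group <#>\<^bsub>QG\<^esub> right_mult_group"
      using set_mult(2) by blast
    have "right_translation ` carrier Q \<subseteq> right_mult_group"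
      unfolding right_mult_group_def by (auto intro: generate.incl)
    then show "right_translation ` carrier Q \<subseteq> left_mult_group <#>\<^bsub>QG\<^esub> right_mult_group"
      using set_mult(3) by blast
  qed
qed

text \<open>A central element c of \<open>M\<close> commutes with all translations, so c(w) = w c(1)
  = c(1) w. Thus c is both translations by z = c(1), and its commuting with translations becomes the
  associativity conditions on z.\<close>

lemma loop_center_nontrivial:
  assumes nontriv: "carrier Q \<noteq> {\<one>}"
  obtains z where "z \<in> loop_center Q" "z \<noteq> \<one>"
proof -
  interpret B: group QG by (rule group_QG)
  obtain M where M: "p_subgroup p QG M"
    "left_translation ` carrier Q \<subseteq> M" "right_translation ` carrier Q \<subseteq> M"
    by (rule mult_group)
  note sM = p_subgroupD[OF M(1)]
  note Mc = subgroup.mem_carrier[OF sM]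
  have fM: "finite M" by (rule p_subgroup_finite[OF prime_p M(1)])
  obtain x where x: "x \<in> carrier Q" "x \<noteq> \<one>" using nontriv one_closed by blast
  interpret F: finite_action QG M M "\<lambda>g h. g \<otimes>\<^bsub>QG\<^esub> h \<otimes>\<^bsub>QG\<^esub> inv\<^bsub>QG\<^esub> g"
  proof (intro finite_action.intro finite_action_axioms.intro B.group_axioms)
    show "g \<otimes>\<^bsub>QG\<^esub> h \<otimes>\<^bsub>QG\<^esub> inv\<^bsub>QG\<^esub> g \<in> M" if "g \<in> M" "h \<in> M" for g h
      using that subgroup.m_closed[OF sM] subgroup.m_inv_closed[OF sM] by simp
    show "\<one>\<^bsub>QG\<^esub> \<otimes>\<^bsub>QG\<^esub> h \<otimes>\<^bsub>QG\<^esub> inv\<^bsub>QG\<^esub> \<one>\<^bsub>QG\<^esub> = h" if "h \<in> M" for h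
      using Mc[OF that] by simp
    show "(g \<otimes>\<^bsub>QG\<^esub> g') \<otimes>\<^bsub>QG\<^esub> h \<otimes>\<^bsub>QG\<^esub> inv\<^bsub>QG\<^esub> (g \<otimes>\<^bsub>QG\<^esub> g')
        = g \<otimes>\<^bsub>QG\<^esub> (g' \<otimes>\<^bsub>QG\<^esub> h \<otimes>\<^bsub>QG\<^esub> inv\<^bsub>QG\<^esub> g') \<otimes>\<^bsub>QG\<^esub> inv\<^bsub>QG\<^esub> g"
      if "g \<in> M" "g' \<in> M" "h \<in> M" for g g' h
      using that Mc by (intro B.conj_conj)
  qed (use sM fM in simp_all)
  \<comment> \<open>The center of \<open>M\<close> is the fixed-point set of conjugation, so its
    size is divisible by p once \<open>M\<close> is nontrivial.\<close>
  define Z where "Z = {h \<in> M. \<forall>g\<in>M. g \<otimes>\<^bsub>QG\<^esub> h \<otimes>\<^bsub>QG\<^esub> inv\<^bsub>QG\<^esub> g = h}"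
  have Z_mod: "card Z mod p = card M mod p"
    unfolding Z_def by (rule F.card_fixed_points_mod[OF prime_p M(1)])
  have oneM: "\<one>\<^bsub>QG\<^esub> \<in> M" by (rule subgroup.one_closed[OF sM])
  have LM: "left_translation x \<in> M" using M(2) x by blast
  have "left_translation x \<one> \<noteq> \<one>\<^bsub>QG\<^esub> \<one>"
    using x one_closed by (simp add: left_translation_def right_one BijGroup_simps)
  then have "\<one>\<^bsub>QG\<^esub> \<noteq> left_translation x" by auto
  then have "card {\<one>\<^bsub>QG\<^esub>, left_translation x} = 2" by simp
  then have "2 \<le> card M" using card_mono[OF fM, of "{\<one>\<^bsub>QG\<^esub>, left_translation x}"] oneM LM by simp
  moreover obtain k where k: "card M = p ^ k" using M(1) by (auto simp: p_subgroup_def)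
  ultimately have "k \<noteq> 0" by (intro notI) simp
  then have "card Z mod p = 0" using Z_mod k by simp
  have "card Z \<noteq> 1" using \<open>card Z mod p = 0\<close> prime_gt_1_nat[OF prime_p] by (intro notI) simp
  moreover have "\<one>\<^bsub>QG\<^esub> \<in> Z" using oneM Mc by (simp add: Z_def)
  ultimately have "Z \<noteq> {\<one>\<^bsub>QG\<^esub>}" by auto
  then obtain c where c: "c \<in> Z" "c \<noteq> \<one>\<^bsub>QG\<^esub>" using \<open>\<one>\<^bsub>QG\<^esub> \<in> Z\<close> by blast
  have cM: "c \<in> M" using c by (simp add: Z_def)
  have M_Bij: "g \<in> Bij (carrier Q)" if "g \<in> M" for g using Mc[OF that] by (simp add: BijGroup_simps)
  have commute: "c (g w) = g (c w)" if g: "g \<in> M" and w: "w \<in> carrier Q" for g w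
  proof -
    have "g \<otimes>\<^bsub>QG\<^esub> c \<otimes>\<^bsub>QG\<^esub> inv\<^bsub>QG\<^esub> g = c" using c g by (simp add: Z_def)
    then have "g \<otimes>\<^bsub>QG\<^esub> c = c \<otimes>\<^bsub>QG\<^esub> g"
      using Mc[OF g] Mc[OF cM] by (metis B.inv_solve_right' B.m_closed)
    then have "(c \<otimes>\<^bsub>QG\<^esub> g) w = (g \<otimes>\<^bsub>QG\<^esub> c) w" by simp
    then show ?thesis using M_Bij[OF g] M_Bij[OF cM] w by (simp add: BijGroup_simps)
  qed
  have cw: "c w \<in> carrier Q" if "w \<in> carrier Q" for w
    using M_Bij[OF cM] that by (rule Bij_app_closed)
  have left: "c (v \<otimes> w) = v \<otimes> c w" if vw: "v \<in> carrier Q" "w \<in> carrier Q" for v w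
  proof -
    have "left_translation v \<in> M" using M(2) vw by blast
    from commute[OF this vw(2)] show ?thesis using vw cw by (simp add: left_translation_def)
  qed
  have right: "c (w \<otimes> v) = c w \<otimes> v" if vw: "v \<in> carrier Q" "w \<in> carrier Q" for v w
  proof -
    have "right_translation v \<in> M" using M(3) vw by blast
    from commute[OF this vw(2)] show ?thesis using vw cw by (simp add: right_translation_def)
  qed
  define z where "z = c \<one>"
  have z: "z \<in> carrier Q" unfolding z_def by (rule cw[OF one_closed])
  have c_right: "c w = w \<otimes> z" if "w \<in> carrier Q" for w
    using left[OF that one_closed] that by (simp add: right_one z_def)
  have c_left: "c w = z \<otimes> w" if "w \<in> carrier Q" for w
    using right[OF that one_closed] that by (simp add: left_one z_def)
  have "z \<noteq> \<one>"
  proof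
    assume "z = \<one>"
    have "c = \<one>\<^bsub>QG\<^esub>"
    proof (rule Bij_eqI[OF M_Bij[OF cM] M_Bij[OF oneM]])
      show "c w = \<one>\<^bsub>QG\<^esub> w" if "w \<in> carrier Q" for w
        using c_left[OF that] that \<open>z = \<one>\<close> by (simp add: left_one BijGroup_simps)
    qed
    then show False using c(2) by simp
  qed
  moreover have "z \<in> loop_center Q"
    unfolding loop_center_def
  proof (intro CollectI conjI ballI)
    fix y w assume yw: "y \<in> carrier Q" "w \<in> carrier Q"
    show "z \<otimes> (y \<otimes> w) = (z \<otimes> y) \<otimes> w"
      using right[OF yw(2,1)] c_left yw by (simp add: mult_closed)
    show "(w \<otimes> y) \<otimes> z = w \<otimes> (y \<otimes> z)"
      using left[OF yw(2,1)] c_right yw by (simp add: mult_closed)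
    show "z \<otimes> y = y \<otimes> z" using c_left c_right yw by simp
  qed (rule z)
  ultimately show ?thesis using that by blast
qed

end

section \<open>The upper central series\<close>

lemma one_FactGroup: "\<one>\<^bsub>G Mod H\<^esub> = H"
  by (simp add: FactGroup_def)

text \<open>Kernels replace explicit normality conditions: their cosets are the fibres of
  \<open>f\<close>, and setwise products of fibres are again fibres.\<close>

locale moufang_epi = Q: moufang_loop Q + R: moufang_loop R
  for Q :: "('a, 'b) monoid_scheme" (structure) and R :: "('c, 'd) monoid_scheme" +
  fixes f :: "'a \<Rightarrow> 'c"
  assumes f_image: "f ` carrier Q = carrier R"
    and f_mult: "\<lbrakk>x \<in> carrier Q; y \<in> carrier Q\<rbrakk> \<Longrightarrow> f (x \<otimes> y) = f x \<otimes>\<^bsub>R\<^esub> f y"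
begin

definition ker :: "'a set" where
  "ker = {x \<in> carrier Q. f x = \<one>\<^bsub>R\<^esub>}"

lemma f_closed: "x \<in> carrier Q \<Longrightarrow> f x \<in> carrier R"
  using f_image by blast

lemma f_one: "f \<one> = \<one>\<^bsub>R\<^esub>"
proof -
  have c: "f \<one> \<in> carrier R" by (rule f_closed[OF Q.one_closed])
  have "f \<one> \<otimes>\<^bsub>R\<^esub> f \<one> = f \<one> \<otimes>\<^bsub>R\<^esub> \<one>\<^bsub>R\<^esub>"
    using f_mult[OF Q.one_closed Q.one_closed] c
    by (simp add: Q.left_one Q.one_closed R.right_one)
  then show ?thesis using R.loop_l_cancel[OF c c R.one_closed] by simp
qed

text \<open>Right cancellation in \<open>R\<close> applied to (y x^-1) x = y solves for the left
  factor, without first showing that \<open>f\<close> respects inverses.\<close>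

lemma f_mult_inverse:
  assumes x: "x \<in> carrier Q" and r: "r \<in> carrier R" and y: "y \<in> carrier Q" "f y = r \<otimes>\<^bsub>R\<^esub> f x"
  shows "f (y \<otimes> inv x) = r"
proof -
  have yx: "y \<otimes> inv x \<in> carrier Q" using x y by (simp add: Q.mult_closed Q.inverse_closed)
  have "f (y \<otimes> inv x) \<otimes>\<^bsub>R\<^esub> f x = f ((y \<otimes> inv x) \<otimes> x)"
    using f_mult[OF yx x] by simp
  also have "\<dots> = r \<otimes>\<^bsub>R\<^esub> f x" using Q.inverse_r_cancel[OF x y(1)] y(2) by simp
  finally show ?thesis
    using R.loop_r_cancel[OF f_closed[OF x] f_closed[OF yx] r] by simp
qed

lemma coset_ker:
  assumes x: "x \<in> carrier Q"
  shows "ker #> x = {y \<in> carrier Q. f y = f x}"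
proof
  show "ker #> x \<subseteq> {y \<in> carrier Q. f y = f x}"
    using x by (auto simp: r_coset_def ker_def f_mult Q.mult_closed R.left_one f_closed)
  show "{y \<in> carrier Q. f y = f x} \<subseteq> ker #> x"
  proof
    fix y assume "y \<in> {y \<in> carrier Q. f y = f x}"
    then have y: "y \<in> carrier Q" "f y = \<one>\<^bsub>R\<^esub> \<otimes>\<^bsub>R\<^esub> f x"
      using x by (simp_all add: R.left_one f_closed)
    then have "y \<otimes> inv x \<in> ker"
      using f_mult_inverse[OF x R.one_closed y] x
      by (simp add: ker_def Q.mult_closed Q.inverse_closed)
    moreover have "y = (y \<otimes> inv x) \<otimes> x" using x y by (simp add: Q.inverse_r_cancel)
    ultimately show "y \<in> ker #> x" by (auto simp: r_coset_def)
  qed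
qed

lemma coset_ker_eq_iff:
  "\<lbrakk>x \<in> carrier Q; y \<in> carrier Q\<rbrakk> \<Longrightarrow> ker #> x = ker #> y \<longleftrightarrow> f x = f y"
  by (auto simp: coset_ker)

lemma ker_eq_coset: "ker = ker #> \<one>"
  using coset_ker[OF Q.one_closed] by (simp add: f_one ker_def)

lemma coset_ker_eq_ker:
  assumes x: "x \<in> carrier Q"
  shows "ker #> x = ker \<longleftrightarrow> x \<in> ker"
proof -
  have "ker #> x = ker \<longleftrightarrow> f x = \<one>\<^bsub>R\<^esub>"
    using coset_ker_eq_iff[OF x Q.one_closed] by (simp only: ker_eq_coset[symmetric] f_one)
  then show ?thesis using x by (simp add: ker_def)
qed

lemma set_mult_coset_ker:
  assumes x: "x \<in> carrier Q" and y: "y \<in> carrier Q"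
  shows "(ker #> x) <#> (ker #> y) = ker #> (x \<otimes> y)"
proof
  have xy: "x \<otimes> y \<in> carrier Q" using x y by (rule Q.mult_closed)
  show "(ker #> x) <#> (ker #> y) \<subseteq> ker #> (x \<otimes> y)"
    using x y by (auto simp: set_mult_def coset_ker xy Q.mult_closed f_mult)
  show "ker #> (x \<otimes> y) \<subseteq> (ker #> x) <#> (ker #> y)"
  proof
    fix w assume "w \<in> ker #> (x \<otimes> y)"
    then have w: "w \<in> carrier Q" "f w = f x \<otimes>\<^bsub>R\<^esub> f y"
      using x y by (simp_all add: coset_ker xy f_mult)
    then have "w \<otimes> inv y \<in> ker #> x"
      using f_mult_inverse[OF y f_closed[OF x] w] x y
      by (simp add: coset_ker Q.mult_closed Q.inverse_closed)
    moreover have "y \<in> ker #> y" using y by (simp add: coset_ker)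
    moreover have "w = (w \<otimes> inv y) \<otimes> y" using w y by (simp add: Q.inverse_r_cancel)
    ultimately show "w \<in> (ker #> x) <#> (ker #> y)" unfolding set_mult_def by blast
  qed
qed

lemma card_coset_ker:
  assumes x: "x \<in> carrier Q"
  shows "card (ker #> x) = card ker"
proof -
  have "ker #> x = (\<lambda>h. h \<otimes> x) ` ker" by (auto simp: r_coset_def)
  moreover have "inj_on (\<lambda>h. h \<otimes> x) ker"
    using x by (intro inj_onI) (simp add: ker_def Q.loop_r_cancel)
  ultimately show ?thesis by (simp add: card_image)
qed

text \<open>Right translations carry the kernel bijectively onto its cosets. This Lagrange formula
  keeps the orders of quotients powers of p.\<close>

lemma card_quotient:
  assumes fin: "finite (carrier Q)"
  shows "card ker * card (carrier (Q Mod ker)) = card (carrier Q)"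
proof -
  have union: "\<Union>(carrier (Q Mod ker)) = carrier Q"
    by (auto simp: carrier_FactGroup coset_ker)
  have "card ker * card (carrier (Q Mod ker)) = card (\<Union>(carrier (Q Mod ker)))"
  proof (rule card_partition)
    show "finite (carrier (Q Mod ker))" using fin by (simp add: carrier_FactGroup)
    show "finite (\<Union>(carrier (Q Mod ker)))" using fin union by simp
    show "card c = card ker" if "c \<in> carrier (Q Mod ker)" for c
      using that card_coset_ker by (auto simp: carrier_FactGroup)
    show "c1 \<inter> c2 = {}"
      if "c1 \<in> carrier (Q Mod ker)" "c2 \<in> carrier (Q Mod ker)" "c1 \<noteq> c2" for c1 c2
      using that by (auto simp: carrier_FactGroup coset_ker)
  qed
  then show ?thesis using union by simp
qed

text \<open>Solutions of division come from \<open>Q\<close>; their uniqueness comes from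
  cancellation in \<open>R\<close>, where cosets are told apart by their values.\<close>

lemma quotient_loop: "moufang_loop (Q Mod ker)"
proof
  fix A B C
  assume "A \<in> carrier (Q Mod ker)" "B \<in> carrier (Q Mod ker)" "C \<in> carrier (Q Mod ker)"
  then obtain a b c where abc: "a \<in> carrier Q" "A = ker #> a" "b \<in> carrier Q" "B = ker #> b"
    "c \<in> carrier Q" "C = ker #> c"
    by (auto simp: carrier_FactGroup)
  then show "A \<otimes>\<^bsub>Q Mod ker\<^esub> B \<otimes>\<^bsub>Q Mod ker\<^esub> A \<otimes>\<^bsub>Q Mod ker\<^esub> C
      = A \<otimes>\<^bsub>Q Mod ker\<^esub> (B \<otimes>\<^bsub>Q Mod ker\<^esub> (A \<otimes>\<^bsub>Q Mod ker\<^esub> C))"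
    by (simp add: FactGroup_def set_mult_coset_ker Q.mult_closed Q.moufang)
next
  fix A B assume "A \<in> carrier (Q Mod ker)" "B \<in> carrier (Q Mod ker)"
  then obtain a b where ab: "a \<in> carrier Q" "A = ker #> a" "b \<in> carrier Q" "B = ker #> b"
    by (auto simp: carrier_FactGroup)
  then show "A \<otimes>\<^bsub>Q Mod ker\<^esub> B \<in> carrier (Q Mod ker)"
    by (auto simp: carrier_FactGroup set_mult_coset_ker Q.mult_closed)
  obtain x where x: "x \<in> carrier Q" "a \<otimes> x = b" using Q.left_division ab by blast
  show "\<exists>!X. X \<in> carrier (Q Mod ker) \<and> A \<otimes>\<^bsub>Q Mod ker\<^esub> X = B"
  proof (rule ex1I[of _ "ker #> x"])
    show "ker #> x \<in> carrier (Q Mod ker) \<and> A \<otimes>\<^bsub>Q Mod ker\<^esub> (ker #> x) = B"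
      using ab x by (auto simp: carrier_FactGroup set_mult_coset_ker)
    fix X assume X: "X \<in> carrier (Q Mod ker) \<and> A \<otimes>\<^bsub>Q Mod ker\<^esub> X = B"
    then obtain y where y: "y \<in> carrier Q" "X = ker #> y" by (auto simp: carrier_FactGroup)
    then have "ker #> (a \<otimes> y) = ker #> (a \<otimes> x)" using X ab x by (simp add: set_mult_coset_ker)
    then have "f (a \<otimes> y) = f (a \<otimes> x)"
      using coset_ker_eq_iff Q.mult_closed[OF ab(1)] x(1) y(1) by blast
    then have "f a \<otimes>\<^bsub>R\<^esub> f y = f a \<otimes>\<^bsub>R\<^esub> f x"
      by (simp only: f_mult ab(1) x(1) y(1))
    then show "X = ker #> x" using ab x y by (simp add: R.loop_l_cancel f_closed coset_ker_eq_iff)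
  qed
  obtain x where x: "x \<in> carrier Q" "x \<otimes> a = b" using Q.right_division ab by blast
  show "\<exists>!X. X \<in> carrier (Q Mod ker) \<and> X \<otimes>\<^bsub>Q Mod ker\<^esub> A = B"
  proof (rule ex1I[of _ "ker #> x"])
    show "ker #> x \<in> carrier (Q Mod ker) \<and> (ker #> x) \<otimes>\<^bsub>Q Mod ker\<^esub> A = B"
      using ab x by (auto simp: carrier_FactGroup set_mult_coset_ker)
    fix X assume X: "X \<in> carrier (Q Mod ker) \<and> X \<otimes>\<^bsub>Q Mod ker\<^esub> A = B"
    then obtain y where y: "y \<in> carrier Q" "X = ker #> y" by (auto simp: carrier_FactGroup)
    then have "ker #> (y \<otimes> a) = ker #> (x \<otimes> a)" using X ab x by (simp add: set_mult_coset_ker)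
    then have "f (y \<otimes> a) = f (x \<otimes> a)"
      using coset_ker_eq_iff Q.mult_closed[OF _ ab(1)] x(1) y(1) by blast
    then have "f y \<otimes>\<^bsub>R\<^esub> f a = f x \<otimes>\<^bsub>R\<^esub> f a"
      by (simp only: f_mult ab(1) x(1) y(1))
    then show "X = ker #> x" using ab x y by (simp add: R.loop_r_cancel f_closed coset_ker_eq_iff)
  qed
next
  have one: "\<one>\<^bsub>Q Mod ker\<^esub> = ker #> \<one>" using ker_eq_coset by (simp add: FactGroup_def)
  then show "\<one>\<^bsub>Q Mod ker\<^esub> \<in> carrier (Q Mod ker)"
    using Q.one_closed by (auto simp: carrier_FactGroup)
  fix A assume "A \<in> carrier (Q Mod ker)"
  then obtain a where a: "a \<in> carrier Q" "A = ker #> a" by (auto simp: carrier_FactGroup)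
  show "\<one>\<^bsub>Q Mod ker\<^esub> \<otimes>\<^bsub>Q Mod ker\<^esub> A = A" "A \<otimes>\<^bsub>Q Mod ker\<^esub> \<one>\<^bsub>Q Mod ker\<^esub> = A"
    unfolding one using a by (simp_all add: set_mult_coset_ker Q.one_closed Q.left_one Q.right_one)
qed

lemma quotient_epi: "moufang_epi Q (Q Mod ker) (\<lambda>x. ker #> x)"
  by (intro moufang_epi.intro moufang_epi_axioms.intro Q.moufang_loop_axioms quotient_loop)
    (simp_all add: carrier_FactGroup set_mult_coset_ker)

end

section \<open>The center as a normal subloop\<close>

context moufang_loop
begin

lemma centerD:
  assumes "z \<in> loop_center Q"
  shows center_closed: "z \<in> carrier Q"
    and center_comm: "x \<in> carrier Q \<Longrightarrow> z \<otimes> x = x \<otimes> z"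
    and center_assoc: "\<lbrakk>x \<in> carrier Q; y \<in> carrier Q\<rbrakk> \<Longrightarrow> (z \<otimes> x) \<otimes> y = z \<otimes> (x \<otimes> y)"
    and center_left_comm: "\<lbrakk>x \<in> carrier Q; y \<in> carrier Q\<rbrakk> \<Longrightarrow> x \<otimes> (z \<otimes> y) = z \<otimes> (x \<otimes> y)"
proof -
  show z: "z \<in> carrier Q" using assms by (simp add: loop_center_def)
  have comm: "z \<otimes> x = x \<otimes> z" if "x \<in> carrier Q" for x
    using assms that by (simp add: loop_center_def)
  then show "x \<in> carrier Q \<Longrightarrow> z \<otimes> x = x \<otimes> z" .
  show "\<lbrakk>x \<in> carrier Q; y \<in> carrier Q\<rbrakk> \<Longrightarrow> (z \<otimes> x) \<otimes> y = z \<otimes> (x \<otimes> y)"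
    using assms by (simp add: loop_center_def)
  show "x \<otimes> (z \<otimes> y) = z \<otimes> (x \<otimes> y)" if "x \<in> carrier Q" "y \<in> carrier Q"
  proof -
    have "(x \<otimes> y) \<otimes> z = x \<otimes> (y \<otimes> z)"
      using assms that unfolding loop_center_def by blast
    then show ?thesis using comm[OF that(2)] comm[OF mult_closed[OF that]] by simp
  qed
qed

text \<open>Equivalent conditions under which central factors can always be moved to the left, the
  form convenient for computing.\<close>

lemma centerI:
  assumes z: "z \<in> carrier Q" and comm: "\<And>x. x \<in> carrier Q \<Longrightarrow> z \<otimes> x = x \<otimes> z"
    and assoc: "\<And>x y. \<lbrakk>x \<in> carrier Q; y \<in> carrier Q\<rbrakk> \<Longrightarrow> (z \<otimes> x) \<otimes> y = z \<otimes> (x \<otimes> y)"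
    and left_comm: "\<And>x y. \<lbrakk>x \<in> carrier Q; y \<in> carrier Q\<rbrakk> \<Longrightarrow> x \<otimes> (z \<otimes> y) = z \<otimes> (x \<otimes> y)"
  shows "z \<in> loop_center Q"
  unfolding loop_center_def
proof (intro CollectI conjI ballI)
  fix y w assume yw: "y \<in> carrier Q" "w \<in> carrier Q"
  show "z \<otimes> (y \<otimes> w) = (z \<otimes> y) \<otimes> w" "z \<otimes> y = y \<otimes> z" using yw assoc comm by simp_all
  show "(w \<otimes> y) \<otimes> z = w \<otimes> (y \<otimes> z)"
    using left_comm[OF yw(2,1)] comm[OF mult_closed[OF yw(2,1)]] comm[OF yw(1)] by simp
qed (rule z)

lemma one_center: "\<one> \<in> loop_center Q"
  by (rule centerI) (simp_all add: one_closed left_one right_one mult_closed)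

lemma center_mult:
  assumes z: "z \<in> loop_center Q" and w: "w \<in> loop_center Q"
  shows "z \<otimes> w \<in> loop_center Q"
proof (rule centerI)
  note zc = center_closed[OF z] and wc = center_closed[OF w]
  show "z \<otimes> w \<in> carrier Q" using zc wc by (rule mult_closed)
  fix x assume x: "x \<in> carrier Q"
  show "z \<otimes> w \<otimes> x = x \<otimes> (z \<otimes> w)"
    using center_assoc[OF z wc x] center_left_comm[OF z x wc] center_comm[OF w x] by simp
  fix y assume y: "y \<in> carrier Q"
  show "z \<otimes> w \<otimes> x \<otimes> y = z \<otimes> w \<otimes> (x \<otimes> y)"
    using x y zc wc by (simp add: center_assoc[OF z] center_assoc[OF w] mult_closed)
  show "x \<otimes> (z \<otimes> w \<otimes> y) = z \<otimes> w \<otimes> (x \<otimes> y)"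
    using center_assoc[OF z wc] center_left_comm[OF z x mult_closed[OF wc y]]
      center_left_comm[OF w x y] mult_closed[OF x y] y by simp
qed

text \<open>Each law is verified after multiplying by z on the left: z can be moved past the other
  factors and cancelled afterwards.\<close>

lemma center_inverse:
  assumes z: "z \<in> loop_center Q"
  shows "inv z \<in> loop_center Q"
proof (rule centerI)
  note zc = center_closed[OF z] and ic = inverse_closed[OF center_closed[OF z]]
  have cancel: "a = b" if "z \<otimes> a = z \<otimes> b" "a \<in> carrier Q" "b \<in> carrier Q" for a b
    using that loop_l_cancel[OF zc] by simp
  show "inv z \<in> carrier Q" by (rule ic)
  fix x assume x: "x \<in> carrier Q"
  show "inv z \<otimes> x = x \<otimes> inv z"
  proof (rule cancel)
    show "z \<otimes> (inv z \<otimes> x) = z \<otimes> (x \<otimes> inv z)"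
      using x ic zc center_left_comm[OF z x ic]
      by (simp add: l_cancel_inverse r_inverse right_one)
  qed (use x ic in \<open>simp_all add: mult_closed\<close>)
  fix y assume y: "y \<in> carrier Q"
  show "inv z \<otimes> x \<otimes> y = inv z \<otimes> (x \<otimes> y)"
  proof (rule cancel)
    show "z \<otimes> (inv z \<otimes> x \<otimes> y) = z \<otimes> (inv z \<otimes> (x \<otimes> y))"
      using x y ic zc center_assoc[OF z, of "inv z \<otimes> x" y]
      by (simp add: l_cancel_inverse mult_closed)
  qed (use x y ic in \<open>simp_all add: mult_closed\<close>)
  show "x \<otimes> (inv z \<otimes> y) = inv z \<otimes> (x \<otimes> y)"
  proof (rule cancel)
    show "z \<otimes> (x \<otimes> (inv z \<otimes> y)) = z \<otimes> (inv z \<otimes> (x \<otimes> y))"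
      using x y ic zc center_left_comm[OF z x, of "inv z \<otimes> y"]
      by (simp add: l_cancel_inverse mult_closed)
  qed (use x y ic in \<open>simp_all add: mult_closed\<close>)
qed

abbreviation "Z \<equiv> loop_center Q"

lemma coset_center: "Z #> x = {z \<otimes> x | z. z \<in> Z}"
  by (auto simp: r_coset_def)

lemma coset_center_eq_iff:
  assumes x: "x \<in> carrier Q" and y: "y \<in> carrier Q"
  shows "Z #> x = Z #> y \<longleftrightarrow> (\<exists>z\<in>Z. x = z \<otimes> y)"
proof
  assume eq: "Z #> x = Z #> y"
  have "\<one> \<otimes> x \<in> Z #> x" unfolding coset_center using one_center by blast
  then have "x \<in> Z #> y" using eq x by (simp add: left_one)
  then show "\<exists>z\<in>Z. x = z \<otimes> y" unfolding coset_center by blast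
next
  have sub: "Z #> (z \<otimes> v) \<subseteq> Z #> v" if z: "z \<in> Z" and v: "v \<in> carrier Q" for z v
  proof
    fix w assume "w \<in> Z #> (z \<otimes> v)"
    then obtain u where u: "u \<in> Z" "w = u \<otimes> (z \<otimes> v)" by (auto simp: coset_center)
    then have "w = (u \<otimes> z) \<otimes> v" using z v center_closed center_assoc by simp
    then show "w \<in> Z #> v" using center_mult[OF u(1) z] by (auto simp: coset_center)
  qed
  assume "\<exists>z\<in>Z. x = z \<otimes> y"
  then obtain z where z: "z \<in> Z" "x = z \<otimes> y" by blast
  then have "y = inv z \<otimes> x" using y by (simp add: inverse_l_cancel center_closed)
  then show "Z #> x = Z #> y"
    using sub[OF z(1) y] sub[OF center_inverse[OF z(1)] x] z(2) by auto
qed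

lemma set_mult_coset_center:
  assumes x: "x \<in> carrier Q" and y: "y \<in> carrier Q"
  shows "(Z #> x) <#> (Z #> y) = Z #> (x \<otimes> y)"
proof
  have prod: "(z \<otimes> x) \<otimes> (w \<otimes> y) = (z \<otimes> w) \<otimes> (x \<otimes> y)" if "z \<in> Z" "w \<in> Z" for z w
  proof -
    have wc: "w \<in> carrier Q" using that(2) by (rule center_closed)
    have "(z \<otimes> x) \<otimes> (w \<otimes> y) = z \<otimes> (x \<otimes> (w \<otimes> y))"
      by (rule center_assoc[OF that(1) x mult_closed[OF wc y]])
    also have "\<dots> = z \<otimes> (w \<otimes> (x \<otimes> y))" using center_left_comm[OF that(2) x y] by simp
    also have "\<dots> = (z \<otimes> w) \<otimes> (x \<otimes> y)"
      by (rule center_assoc[OF that(1) wc mult_closed[OF x y], symmetric])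
    finally show ?thesis .
  qed
  show "(Z #> x) <#> (Z #> y) \<subseteq> Z #> (x \<otimes> y)"
    using prod center_mult by (auto simp: set_mult_def coset_center)
  show "Z #> (x \<otimes> y) \<subseteq> (Z #> x) <#> (Z #> y)"
  proof
    fix v assume "v \<in> Z #> (x \<otimes> y)"
    then obtain z where z: "z \<in> Z" "v = z \<otimes> (x \<otimes> y)" by (auto simp: coset_center)
    then have "v = (z \<otimes> x) \<otimes> (\<one> \<otimes> y)" using x y by (simp add: center_assoc left_one)
    then show "v \<in> (Z #> x) <#> (Z #> y)"
      using z(1) one_center unfolding set_mult_def coset_center by blast
  qed
qed

text \<open>The center is not given as a kernel, so the loop axioms are checked directly. Uniqueness
  of division holds since a y = z (a x) with central z becomes a y = a (z x).\<close>

lemma center_quotient_loop: "moufang_loop (Q Mod Z)"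
proof
  fix A B C
  assume "A \<in> carrier (Q Mod Z)" "B \<in> carrier (Q Mod Z)" "C \<in> carrier (Q Mod Z)"
  then obtain a b c where abc: "a \<in> carrier Q" "A = Z #> a" "b \<in> carrier Q" "B = Z #> b"
    "c \<in> carrier Q" "C = Z #> c"
    by (auto simp: carrier_FactGroup)
  then show "A \<otimes>\<^bsub>Q Mod Z\<^esub> B \<otimes>\<^bsub>Q Mod Z\<^esub> A \<otimes>\<^bsub>Q Mod Z\<^esub> C
      = A \<otimes>\<^bsub>Q Mod Z\<^esub> (B \<otimes>\<^bsub>Q Mod Z\<^esub> (A \<otimes>\<^bsub>Q Mod Z\<^esub> C))"
    by (simp add: FactGroup_def set_mult_coset_center mult_closed moufang)
next
  fix A B assume "A \<in> carrier (Q Mod Z)" "B \<in> carrier (Q Mod Z)"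
  then obtain a b where ab: "a \<in> carrier Q" "A = Z #> a" "b \<in> carrier Q" "B = Z #> b"
    by (auto simp: carrier_FactGroup)
  then show "A \<otimes>\<^bsub>Q Mod Z\<^esub> B \<in> carrier (Q Mod Z)"
    by (auto simp: carrier_FactGroup set_mult_coset_center mult_closed)
  obtain x where x: "x \<in> carrier Q" "a \<otimes> x = b" using left_division ab by blast
  show "\<exists>!X. X \<in> carrier (Q Mod Z) \<and> A \<otimes>\<^bsub>Q Mod Z\<^esub> X = B"
  proof (rule ex1I[of _ "Z #> x"])
    show "Z #> x \<in> carrier (Q Mod Z) \<and> A \<otimes>\<^bsub>Q Mod Z\<^esub> (Z #> x) = B"
      using ab x by (auto simp: carrier_FactGroup set_mult_coset_center)
    fix X assume X: "X \<in> carrier (Q Mod Z) \<and> A \<otimes>\<^bsub>Q Mod Z\<^esub> X = B"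
    then obtain y where y: "y \<in> carrier Q" "X = Z #> y" by (auto simp: carrier_FactGroup)
    then have "Z #> (a \<otimes> y) = Z #> (a \<otimes> x)" using X ab x by (simp add: set_mult_coset_center)
    then obtain z where z: "z \<in> Z" "a \<otimes> y = z \<otimes> (a \<otimes> x)"
      using ab x y by (auto simp: coset_center_eq_iff mult_closed)
    then have "a \<otimes> y = a \<otimes> (z \<otimes> x)" using center_left_comm[OF z(1) ab(1) x(1)] by simp
    then have "y = z \<otimes> x" using ab x y z by (simp add: loop_l_cancel mult_closed center_closed)
    then show "X = Z #> x" using x y z by (auto simp: coset_center_eq_iff)
  qed
  obtain x where x: "x \<in> carrier Q" "x \<otimes> a = b" using right_division ab by blast
  show "\<exists>!X. X \<in> carrier (Q Mod Z) \<and> X \<otimes>\<^bsub>Q Mod Z\<^esub> A = B"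
  proof (rule ex1I[of _ "Z #> x"])
    show "Z #> x \<in> carrier (Q Mod Z) \<and> (Z #> x) \<otimes>\<^bsub>Q Mod Z\<^esub> A = B"
      using ab x by (auto simp: carrier_FactGroup set_mult_coset_center)
    fix X assume X: "X \<in> carrier (Q Mod Z) \<and> X \<otimes>\<^bsub>Q Mod Z\<^esub> A = B"
    then obtain y where y: "y \<in> carrier Q" "X = Z #> y" by (auto simp: carrier_FactGroup)
    then have "Z #> (y \<otimes> a) = Z #> (x \<otimes> a)" using X ab x by (simp add: set_mult_coset_center)
    then obtain z where z: "z \<in> Z" "y \<otimes> a = z \<otimes> (x \<otimes> a)"
      using ab x y by (auto simp: coset_center_eq_iff mult_closed)
    then have "y \<otimes> a = (z \<otimes> x) \<otimes> a" using center_assoc[OF z(1) x(1) ab(1)] by simp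
    then have "y = z \<otimes> x" using ab x y z by (simp add: loop_r_cancel mult_closed center_closed)
    then show "X = Z #> x" using x y z by (auto simp: coset_center_eq_iff)
  qed
next
  have "Z #> \<one> = Z" unfolding coset_center using center_closed right_one by force
  then have one: "\<one>\<^bsub>Q Mod Z\<^esub> = Z #> \<one>" by (simp add: FactGroup_def)
  then show "\<one>\<^bsub>Q Mod Z\<^esub> \<in> carrier (Q Mod Z)"
    using one_closed by (auto simp: carrier_FactGroup)
  fix A assume "A \<in> carrier (Q Mod Z)"
  then obtain a where a: "a \<in> carrier Q" "A = Z #> a" by (auto simp: carrier_FactGroup)
  show "\<one>\<^bsub>Q Mod Z\<^esub> \<otimes>\<^bsub>Q Mod Z\<^esub> A = A" "A \<otimes>\<^bsub>Q Mod Z\<^esub> \<one>\<^bsub>Q Mod Z\<^esub> = A"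
    unfolding one using a by (simp_all add: set_mult_coset_center one_closed left_one right_one)
qed

lemma coset_center_eq_center:
  assumes "x \<in> carrier Q"
  shows "Z #> x = Z \<longleftrightarrow> x \<in> Z"
proof -
  have "Z #> \<one> = Z" unfolding coset_center using center_closed right_one by force
  then have "Z #> x = Z \<longleftrightarrow> (\<exists>z\<in>Z. x = z \<otimes> \<one>)"
    using coset_center_eq_iff[OF assms one_closed] by simp
  also have "\<dots> \<longleftrightarrow> x \<in> Z" using center_closed right_one by force
  finally show ?thesis .
qed

text \<open>Each term of the upper central series is the kernel of an epimorphism: of the identity, and
  then of \<open>Q \<rightarrow> Q/N \<rightarrow> (Q/N)/Z(Q/N)\<close>.\<close>

lemma upper_center_quotient:
  "moufang_epi Q (Q Mod upper_center Q i) (\<lambda>x. upper_center Q i #> x)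
    \<and> moufang_epi.ker Q (Q Mod upper_center Q i) (\<lambda>x. upper_center Q i #> x) = upper_center Q i"
proof -
  \<comment> \<open>Once \<open>K\<close> is a kernel of some epimorphism, the coset map of
    \<open>K\<close> is another one with the same kernel. As the type of \<open>R\<close> is
    arbitrary, this replaces the iterated quotient, made of sets of sets, by a quotient of
    \<open>Q\<close> itself.\<close>
  have kernel: "moufang_epi Q (Q Mod K) (\<lambda>x. K #> x) \<and> moufang_epi.ker Q (Q Mod K) (\<lambda>x. K #> x) = K"
    if epi: "moufang_epi Q R f" and K: "moufang_epi.ker Q R f = K"
    for R :: "('e, 'f) monoid_scheme" and f K
  proof -
    interpret E: moufang_epi Q R f by (rule epi)
    have KE: "K = E.ker" using K by simp
    interpret K: moufang_epi Q "Q Mod K" "\<lambda>x. K #> x"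
      unfolding KE by (rule E.quotient_epi)
    have "K.ker = {x \<in> carrier Q. K #> x = K}"
      by (simp only: K.ker_def one_FactGroup)
    moreover have "E.ker \<subseteq> carrier Q" by (auto simp: E.ker_def)
    then have "{x \<in> carrier Q. K #> x = K} = K"
      unfolding KE using E.coset_ker_eq_ker by blast
    ultimately have "K.ker = K" by simp
    then show ?thesis using K.moufang_epi_axioms by blast
  qed
  show ?thesis
  proof (induction i)
    case 0
    interpret E: moufang_epi Q Q "\<lambda>x. x" by unfold_locales simp_all
    have "E.ker = {\<one>}" using one_closed by (auto simp: E.ker_def)
    then show ?case unfolding upper_center.simps by (rule kernel[OF E.moufang_epi_axioms])
  next
    case (Suc i)
    let ?N = "upper_center Q i"
    interpret E: moufang_epi Q "Q Mod ?N" "\<lambda>x. ?N #> x" using Suc by blast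
    let ?C = "loop_center (Q Mod ?N)"
    let ?f = "\<lambda>x. ?C #>\<^bsub>Q Mod ?N\<^esub> (?N #> x)"
    interpret F: moufang_epi Q "(Q Mod ?N) Mod ?C" ?f
    proof (intro moufang_epi.intro moufang_epi_axioms.intro moufang_loop_axioms E.R.center_quotient_loop)
      show "?f ` carrier Q = carrier ((Q Mod ?N) Mod ?C)"
        by (auto simp: carrier_FactGroup)
      show "?f (x \<otimes> y) = ?f x \<otimes>\<^bsub>(Q Mod ?N) Mod ?C\<^esub> ?f y"
        if "x \<in> carrier Q" "y \<in> carrier Q" for x y
        using that E.f_closed E.f_mult E.R.set_mult_coset_center by simp
    qed
    have "F.ker = {x \<in> carrier Q. ?N #> x \<in> ?C}"
      unfolding F.ker_def one_FactGroup
      by (intro Collect_cong conj_cong refl) (rule E.R.coset_center_eq_center[OF E.f_closed])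
    then have "F.ker = upper_center Q (Suc i)" by simp
    then show ?case by (rule kernel[OF F.moufang_epi_axioms])
  qed
qed

end

text \<open>The quotient is again a Moufang loop of p-power order, nontrivial by assumption, and a
  nontrivial central coset pulls back to an element outside \<open>upper_center Q i\<close>.\<close>

lemma (in moufang_p_loop) upper_center_grows:
  assumes "upper_center Q i \<noteq> carrier Q"
  shows "upper_center Q i \<subset> upper_center Q (Suc i)"
proof -
  let ?N = "upper_center Q i"
  interpret E: moufang_epi Q "Q Mod ?N" "\<lambda>x. ?N #> x" using upper_center_quotient by blast
  have E_ker: "E.ker = ?N" using upper_center_quotient by blast
  have "card (carrier (Q Mod ?N)) dvd p ^ n"
    using E.card_quotient[OF finite_carrier, unfolded E_ker]
    by (intro dvdI[of _ _ "card ?N"]) (simp only: card_carrier mult.commute)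
  then obtain k where "card (carrier (Q Mod ?N)) = p ^ k"
    using divides_primepow_nat[OF prime_p] by blast
  then interpret P: moufang_p_loop "Q Mod ?N" p k
    using finite_carrier prime_p by unfold_locales (simp_all add: carrier_FactGroup)
  have one: "\<one>\<^bsub>Q Mod ?N\<^esub> = ?N" by (simp add: FactGroup_def)
  have "E.ker \<subseteq> carrier Q" by (auto simp: E.ker_def)
  then have N_sub: "?N \<subseteq> carrier Q" by (simp only: E_ker)
  have N_iff: "?N #> x = ?N \<longleftrightarrow> x \<in> ?N" if "x \<in> carrier Q" for x
    using E.coset_ker_eq_ker[OF that] by (simp only: E_ker)
  obtain x where x: "x \<in> carrier Q" "x \<notin> ?N" using assms N_sub by blast
  then have "carrier (Q Mod ?N) \<noteq> {\<one>\<^bsub>Q Mod ?N\<^esub>}"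
    using N_iff[OF x(1)] E.f_closed[OF x(1)] one by auto
  then obtain c where c: "c \<in> loop_center (Q Mod ?N)" "c \<noteq> \<one>\<^bsub>Q Mod ?N\<^esub>"
    by (rule P.loop_center_nontrivial)
  obtain y where y: "y \<in> carrier Q" "c = ?N #> y"
    using E.R.center_closed[OF c(1)] by (auto simp: carrier_FactGroup)
  then have "y \<in> upper_center Q (Suc i)" "y \<notin> ?N"
    using c N_iff one by auto
  moreover have "?N \<subseteq> upper_center Q (Suc i)"
  proof
    fix x assume x: "x \<in> ?N"
    then have "x \<in> carrier Q" using N_sub by blast
    moreover from this have "?N #> x = ?N" using N_iff x by simp
    ultimately show "x \<in> upper_center Q (Suc i)" using E.R.one_center one by simp
  qed
  ultimately show ?thesis by blast
qed

theorem mainTheorem2: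
  fixes p :: nat and Q :: "('a, 'b) monoid_scheme"
  assumes "prime p"
    and "finite_moufang_p_loop p Q"
  shows "centrally_nilpotent Q"
proof (rule ccontr)
  obtain n where n: "card (carrier Q) = p ^ n"
    using assms(2) by (auto simp: finite_moufang_p_loop_def order_def)
  interpret moufang_p_loop Q p n
    using assms n
    by (auto simp: finite_moufang_p_loop_def moufang_p_loop_def moufang_p_loop_axioms_def)
  assume "\<not> centrally_nilpotent Q"
  then have grows: "upper_center Q i \<subset> upper_center Q (Suc i)" for i
    using upper_center_grows by (simp add: centrally_nilpotent_def del: upper_center.simps)
  have sub: "upper_center Q i \<subseteq> carrier Q" for i
    using one_closed by (cases i) auto
  \<comment> \<open>Each strict inclusion adds an element, so the index one above the order of
    \<open>Q\<close> is impossible.\<close>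
  have "i \<le> card (upper_center Q i)" for i
  proof (induction i)
    case (Suc i)
    have "card (upper_center Q i) < card (upper_center Q (Suc i))"
      using finite_subset[OF sub finite_carrier] grows by (rule psubset_card_mono)
    then show ?case using Suc by simp
  qed simp
  then have "Suc (card (carrier Q)) \<le> card (carrier Q)"
    using card_mono[OF finite_carrier sub] order_trans by blast
  then show False by simp
qed

end
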